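(* Let $f\colon[0,\infty)\times\mathbb{N}_0\to[0,\infty)$ satisfy $|f(\lambda,y)-f(\lambda',y')|\le \kappa_1|\lambda-\lambda'|+\kappa_2|y-y'|$ for all $\lambda,\lambda'\ge0$, $y,y'\in\mathbb{N}_0$, with constants $\kappa_1,\kappa_2\ge0$, $\kappa:=\kappa_1+\kappa_2<1$. Let $((N_t,\lambda_t))_{t\in\mathbb{Z}}$ be a strictly stationary process (in its stationary regime) with values in $\mathbb{N}_0\times[0,\infty)$ such that for all $t$, $N_t$ conditionally on $\sigma(\lambda_s,N_s: s\le t-1)$ (together with $\lambda_t$) is $\mathrm{Poisson}(\lambda_t)$ distributed, and $\lambda_t=f(\lambda_{t-1},N_{t-1})$. Then: (i) the count process $(N_t)_{t\in\mathbb{Z}}$ is absolutely regular, with coefficients satisfying $\beta(n)\le 2E\lambda_1\,\kappa^{n-1}/(1-\kappa_1)$ for all $n\in\mathbb{N}$; (ii) there is a measurable function $g\colon\mathbb{N}_0^\infty\to[0,\infty)$ such that $\lambda_t=g(N_{t-1},N_{t-2},\dots)$ almost surely for all $t\in\mathbb{Z}$; (iii) the process $((N_t,\lambda_t))_{t\in\mathbb{Z}}$ is ergodic; (iv) $E\lambda_1^2<\infty$.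
   Context: For $-\infty\le k\le l\le\infty$ let $\mathcal{B}^N_{k,l}=\sigma(N_k,\dots,N_l)$. The absolute regularity ($\beta$-mixing) coefficients of $(N_t)$ are $\beta(n)=E\big[\sup_{A\in\mathcal{B}^N_{n,\infty}}|P(A\mid\mathcal{B}^N_{-\infty,0})-P(A)|\big]$; the process is absolutely regular if $\beta(n)\to0$. $\mathbb{N}_0^\infty$ is the set of sequences $(n_1,n_2,\dots)$ with $n_i\in\mathbb{N}_0$, with the product $\sigma$-field. *)

theory Defs
  imports "HOL-Probability.Probability"
begin

definition count_sigma :: "'a measure \<Rightarrow> (int \<Rightarrow> 'a \<Rightarrow> nat) \<Rightarrow> int set \<Rightarrow> 'a measure" where
  "count_sigma M N I = sigma (space M) {N s -` B \<inter> space M | s B. s \<in> I}"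

definition past_sigma :: "'a measure \<Rightarrow> (int \<Rightarrow> 'a \<Rightarrow> nat) \<Rightarrow> (int \<Rightarrow> 'a \<Rightarrow> real) \<Rightarrow> int \<Rightarrow> 'a measure" where
  "past_sigma M N lam t = sigma (space M)
     ({N s -` B \<inter> space M | s B. s \<le> t} \<union>
      {lam s -` B \<inter> space M | s B. s \<le> t \<and> B \<in> sets borel})"

definition is_reg_cond_prob :: "'a measure \<Rightarrow> 'a measure \<Rightarrow> 'a measure \<Rightarrow> ('a \<Rightarrow> 'a measure) \<Rightarrow> bool" where
  "is_reg_cond_prob M G H K \<longleftrightarrow>
     K \<in> measurable G (prob_algebra H) \<and>
     (\<forall>A\<in>sets H. AE \<omega> in M. measure (K \<omega>) A = real_cond_exp M G (indicator A) \<omega>)"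

definition abs_reg_coeff :: "'a measure \<Rightarrow> 'a measure \<Rightarrow> 'a measure \<Rightarrow> ennreal" where
  "abs_reg_coeff M G H =
     (let K = (SOME K. is_reg_cond_prob M G H K)
      in \<integral>\<^sup>+ \<omega>. (\<Squnion>A\<in>sets H. ennreal \<bar>measure (K \<omega>) A - measure M A\<bar>) \<partial>M)"

definition beta_coeff :: "'a measure \<Rightarrow> (int \<Rightarrow> 'a \<Rightarrow> nat) \<Rightarrow> nat \<Rightarrow> ennreal" where
  "beta_coeff M N n = abs_reg_coeff M (count_sigma M N {..0}) (count_sigma M N {int n..})"

definition absolutely_regular :: "'a measure \<Rightarrow> (int \<Rightarrow> 'a \<Rightarrow> nat) \<Rightarrow> bool" where
  "absolutely_regular M N \<longleftrightarrow> (\<lambda>n. beta_coeff M N n) \<longlonglongrightarrow> 0"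

text \<open>Path space (N_0 x [0,inf))^Z (as a subset of (N_0 x R)^Z), and the law of the process.\<close>
definition path_space :: "(int \<Rightarrow> nat \<times> real) measure" where
  "path_space = PiM (UNIV :: int set) (\<lambda>_. count_space (UNIV :: nat set) \<Otimes>\<^sub>M (borel :: real measure))"

definition shift_path :: "int \<Rightarrow> (int \<Rightarrow> 'b) \<Rightarrow> (int \<Rightarrow> 'b)" where
  "shift_path h x = (\<lambda>t. x (t + h))"

definition path_law :: "'a measure \<Rightarrow> (int \<Rightarrow> 'a \<Rightarrow> nat) \<Rightarrow> (int \<Rightarrow> 'a \<Rightarrow> real) \<Rightarrow> (int \<Rightarrow> nat \<times> real) measure" where
  "path_law M N lam = distr M path_space (\<lambda>\<omega> t. (N t \<omega>, lam t \<omega>))"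

definition strictly_stationary :: "'a measure \<Rightarrow> (int \<Rightarrow> 'a \<Rightarrow> nat) \<Rightarrow> (int \<Rightarrow> 'a \<Rightarrow> real) \<Rightarrow> bool" where
  "strictly_stationary M N lam \<longleftrightarrow>
     (\<forall>h::int. distr M path_space (\<lambda>\<omega>. shift_path h (\<lambda>t. (N t \<omega>, lam t \<omega>))) = path_law M N lam)"

definition ergodic_process :: "'a measure \<Rightarrow> (int \<Rightarrow> 'a \<Rightarrow> nat) \<Rightarrow> (int \<Rightarrow> 'a \<Rightarrow> real) \<Rightarrow> bool" where
  "ergodic_process M N lam \<longleftrightarrow>
     (\<forall>A\<in>sets path_space. shift_path 1 -` A \<inter> space path_space = A \<longrightarrow>
        emeasure (path_law M N lam) A = 0 \<or> emeasure (path_law M N lam) A = 1)"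

end

theory Submission
  imports Defs
begin

text \<open>
  Given the past, the law of the future counts depends on the past only through the current intensity,
  and it does so in a Lipschitz way: the derivative of a Poisson expectation in its intensity is the
  expectation of a forward difference, so one step of the chain turns a \<open>c\<close>-Lipschitz function of
  the intensity into a \<open>(\<kappa>\<^sub>1 + \<kappa>\<^sub>2) c\<close>-Lipschitz one, and events decided by finitely many counts have
  conditional probabilities that are \<open>1 / (1 - \<kappa>\<^sub>1)\<close>-Lipschitz. By approximation the same holds for all
  events in the \<open>\<sigma>\<close>-field of the counts from time \<open>n\<close> on, with constant \<open>(\<kappa>\<^sub>1 + \<kappa>\<^sub>2) ^ (n - 1) / (1 - \<kappa>\<^sub>1)\<close>
  in the intensity at time 1.

  The underlying probability space is arbitrary, so the existence of a regular conditional probability has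
  to be proved: Lipschitz versions are unique on the support of the law of the intensity, hence
  they are \<open>\<sigma>\<close>-additive in the event for every value of the intensity in that support. Their
  oscillation bounds the mixing coefficients. The intensity is the limit of the contractive backward
  recursion in the counts, so shift invariant events are determined by the counts; by mixing they are
  independent of every past event, hence of themselves.
\<close>

section \<open>Poisson expectations\<close>

text \<open>Two kinds of step produce the constants. A tree that branches on the current count may
  put unrelated events at neighbouring counts, so the forward difference is only known to be at most
  1, and the constant solves \<open>c = \<kappa>\<^sub>1 * c + 1\<close>. A step before time
  \<open>n\<close> ignores the count, so the difference is at most
  \<open>\<kappa>\<^sub>2 * c\<close> and the constant contracts. The factor \<open>2 * E\<close>
  comes from |x - y| <= x + y for two intensities, integrated over both.

  The coefficient is defined by \<open>SOME\<close> regular conditional probability, so a bound for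
  one kernel says nothing until existence and almost sure uniqueness are settled. Ordinary
  conditional probabilities have a null set for each of uncountably many events; a Lipschitz version
  has a determined value at each point of the support. The coefficient conditions on counts alone,
  the Poisson hypothesis on counts and intensities; reconstructing the intensity from the counts
  reconciles the two. The second moment comes from a quadratic drift inequality and also supplies
  the finite mean that enters every bound.\<close>

definition poisson_weight :: "real \<Rightarrow> nat \<Rightarrow> real" where
  "poisson_weight x k = exp (- x) * x ^ k / fact k"

lemma poisson_weight_nonneg [simp]: "0 \<le> x \<Longrightarrow> 0 \<le> poisson_weight x k"
  by (simp add: poisson_weight_def)

lemma borel_measurable_poisson_weight [measurable]: "(\<lambda>x. poisson_weight x k) \<in> borel_measurable borel"
  unfolding poisson_weight_def by measurable

text \<open>Shifting the index trades a factor \<open>k\<close> for a factor \<open>x\<close>, which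
  reduces each moment series to series of lower order.\<close>

lemma poisson_weight_Suc: "poisson_weight x (Suc k) * real (Suc k) = x * poisson_weight x k"
  by (simp add: poisson_weight_def del: of_nat_Suc)

lemma poisson_weight_sums: "poisson_weight x sums 1"
proof -
  have "(\<lambda>k. exp (-x) * (x ^ k /\<^sub>R fact k)) sums (exp (-x) * exp x)"
    by (intro sums_mult exp_converges)
  moreover have "(\<lambda>k. exp (-x) * (x ^ k /\<^sub>R fact k)) = poisson_weight x"
    by (auto simp: poisson_weight_def fun_eq_iff divide_simps)
  ultimately show ?thesis
    by (simp flip: exp_add)
qed

lemma poisson_weight_summable: "summable (poisson_weight x)"
  using poisson_weight_sums by (rule sums_summable)

lemma poisson_mean_sums: "(\<lambda>k. poisson_weight x k * real k) sums x"
proof -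
  have "(\<lambda>k. poisson_weight x (Suc k) * real (Suc k)) sums (x * 1)"
    unfolding poisson_weight_Suc by (intro sums_mult poisson_weight_sums)
  from sums_Suc[OF this] show ?thesis by simp
qed

lemma poisson_second_moment_sums: "(\<lambda>k. poisson_weight x k * (real k)\<^sup>2) sums (x\<^sup>2 + x)"
proof -
  have "(\<lambda>k. x * (poisson_weight x k * real k + poisson_weight x k)) sums (x * (x + 1))"
    by (intro sums_mult sums_add poisson_weight_sums poisson_mean_sums)
  moreover have "x * (poisson_weight x k * real k + poisson_weight x k)
      = poisson_weight x (Suc k) * (real (Suc k))\<^sup>2" for k
    unfolding power2_eq_square mult.assoc[symmetric] poisson_weight_Suc by (simp add: algebra_simps)
  ultimately have "(\<lambda>k. poisson_weight x (Suc k) * (real (Suc k))\<^sup>2) sums (x * (x + 1))"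
    by simp
  from sums_Suc[OF this] show ?thesis by (simp add: power2_eq_square algebra_simps)
qed

lemma poisson_expectation_summable:
  assumes "0 \<le> x" and "\<And>k. \<bar>u k\<bar> \<le> B"
  shows "summable (\<lambda>k. poisson_weight x k * u k)"
proof (rule summable_comparison_test')
  show "summable (\<lambda>k. poisson_weight x k * B)"
    by (intro summable_mult2 poisson_weight_summable)
  show "norm (poisson_weight x k * u k) \<le> poisson_weight x k * B" if "0 \<le> k" for k
    using assms by (auto simp: abs_mult intro!: mult_left_mono)
qed

lemma poisson_expectation_abs_le:
  assumes "0 \<le> x" and "\<And>k. \<bar>u k\<bar> \<le> B"
  shows "\<bar>\<Sum>k. poisson_weight x k * u k\<bar> \<le> B"
proof -
  have le: "\<bar>poisson_weight x k * u k\<bar> \<le> poisson_weight x k * B" for k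
    using assms by (auto simp: abs_mult intro!: mult_left_mono)
  have s: "summable (\<lambda>k. poisson_weight x k * B)"
    by (intro summable_mult2 poisson_weight_summable)
  have "\<bar>\<Sum>k. poisson_weight x k * u k\<bar> \<le> (\<Sum>k. \<bar>poisson_weight x k * u k\<bar>)"
    by (intro summable_rabs summable_comparison_test'[OF s]) (simp add: le)
  also have "\<dots> \<le> (\<Sum>k. poisson_weight x k * B)"
    by (intro suminf_le le s summable_comparison_test'[OF s]) (simp add: le)
  also have "\<dots> = B"
    using sums_mult2[OF poisson_weight_sums, of x B] by (simp add: sums_iff)
  finally show ?thesis .
qed

lemma poisson_expectation_bounds:
  assumes "0 \<le> x" and "\<And>k. 0 \<le> u k" and "\<And>k. u k \<le> B"
  shows "0 \<le> (\<Sum>k. poisson_weight x k * u k)" "(\<Sum>k. poisson_weight x k * u k) \<le> B"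
proof -
  have b: "\<bar>u k\<bar> \<le> B" for k using assms(2,3)[of k] by simp
  show "0 \<le> (\<Sum>k. poisson_weight x k * u k)"
    using assms by (intro suminf_nonneg poisson_expectation_summable[OF _ b]) auto
  show "(\<Sum>k. poisson_weight x k * u k) \<le> B"
    using poisson_expectation_abs_le[of x u B, OF assms(1) b] by simp
qed

text \<open>Up to the factor \<open>exp (-x)\<close> the expectation is the exponential generating
  function of \<open>u\<close>. Differentiating that function shifts \<open>u\<close> by one, and
  differentiating the factor contributes the subtracted term.\<close>

lemma DERIV_poisson_expectation:
  assumes u: "\<And>k. \<bar>u k\<bar> \<le> B"
  shows "((\<lambda>x. \<Sum>k. poisson_weight x k * u k) has_field_derivative
           (\<Sum>k. poisson_weight x k * (u (Suc k) - u k))) (at x)"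
proof -
  define c where "c v k = v k / fact k" for v :: "nat \<Rightarrow> real" and k
  have sm: "summable (\<lambda>k. c v k * y ^ k)" if "\<And>k. \<bar>v k\<bar> \<le> B" for v and y :: real
  proof (rule summable_comparison_test')
    show "summable (\<lambda>k. B * (inverse (fact k) * \<bar>y\<bar> ^ k))"
      by (intro summable_mult summable_exp)
    show "norm (c v k * y ^ k) \<le> B * (inverse (fact k) * \<bar>y\<bar> ^ k)" if "0 \<le> k" for k
      using \<open>\<And>k. \<bar>v k\<bar> \<le> B\<close>[of k]
      by (auto simp: c_def abs_mult power_abs divide_inverse mult.assoc intro!: mult_right_mono)
  qed
  have E: "poisson_weight y k * v k = exp (-y) * (c v k * y ^ k)" for y k v
    by (simp add: poisson_weight_def c_def)
  have E': "(\<Sum>k. poisson_weight y k * v k) = exp (-y) * (\<Sum>k. c v k * y ^ k)"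
    if "\<And>k. \<bar>v k\<bar> \<le> B" for v y
    unfolding E by (intro suminf_mult sm that)
  have d: "diffs (c u) = c (\<lambda>k. u (Suc k))"
    by (auto simp: diffs_def c_def fun_eq_iff divide_simps)
  have "((\<lambda>x. exp (-x) * (\<Sum>k. c u k * x ^ k)) has_field_derivative
          (exp (-x) * (\<Sum>k. diffs (c u) k * x ^ k) + - exp (-x) * (\<Sum>k. c u k * x ^ k))) (at x)"
    by (rule derivative_eq_intros refl termdiffs_strong_converges_everywhere sm u)+ simp
  also have "exp (-x) * (\<Sum>k. diffs (c u) k * x ^ k) + - exp (-x) * (\<Sum>k. c u k * x ^ k)
      = (\<Sum>k. poisson_weight x k * u (Suc k)) - (\<Sum>k. poisson_weight x k * u k)"
    unfolding d by (subst (1 2) E') (auto simp: u)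
  also have "\<dots> = (\<Sum>k. poisson_weight x k * (u (Suc k) - u k))"
    unfolding right_diff_distrib
    by (rule suminf_diff) (simp_all add: E[where v = u] E[where v = "\<lambda>k. u (Suc k)"] summable_mult sm u)
  also have "(\<lambda>x. exp (-x) * (\<Sum>k. c u k * x ^ k)) = (\<lambda>x. \<Sum>k. poisson_weight x k * u k)"
    by (subst E') (auto simp: u)
  finally show ?thesis .
qed

lemma poisson_expectation_lipschitz:
  assumes "0 \<le> x" "0 \<le> y"
    and u: "\<And>k. \<bar>u k\<bar> \<le> B" and L: "\<And>k. \<bar>u (Suc k) - u k\<bar> \<le> L"
  shows "\<bar>(\<Sum>k. poisson_weight x k * u k) - (\<Sum>k. poisson_weight y k * u k)\<bar> \<le> L * \<bar>x - y\<bar>"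
proof -
  define H where "H x = (\<Sum>k. poisson_weight x k * u k)" for x
  have "norm (H x - H y) \<le> L * norm (x - y)"
  proof (rule field_differentiable_bound[where S = "{0..}"])
    show "(H has_field_derivative (\<Sum>k. poisson_weight z k * (u (Suc k) - u k))) (at z within {0..})"
      for z unfolding H_def[abs_def]
      by (rule has_field_derivative_at_within, rule DERIV_poisson_expectation, rule u)
    show "norm (\<Sum>k. poisson_weight z k * (u (Suc k) - u k)) \<le> L" if "z \<in> {0..}" for z
      using poisson_expectation_abs_le[of z "\<lambda>k. u (Suc k) - u k" L] L that by simp
  qed (use assms in auto)
  then show ?thesis by (simp add: H_def)
qed

section \<open>Approximation of events by a generating algebra\<close>

lemma (in prob_space) approximate_by_algebra:
  assumes G: "algebra (space M) \<A>" "\<A> \<subseteq> sets M" and A: "A \<in> sigma_sets (space M) \<A>" and "0 < e"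
  shows "\<exists>B\<in>\<A>. measure M (sym_diff A B) < e"
proof -
  interpret algebra "space M" \<A> by fact
  have meas: "B \<in> sets M" if "B \<in> sigma_sets (space M) \<A>" for B
    using that sets.sigma_sets_subset[OF G(2)] by blast
  show ?thesis
    using A \<open>0 < e\<close>
  proof (induction arbitrary: e rule: sigma_sets.induct)
    case (Basic a) then show ?case by (intro bexI[of _ a]) auto
  next
    case Empty then show ?case by (intro bexI[of _ "{}"]) auto
  next
    case (Compl a)
    then obtain B where B: "B \<in> \<A>" "measure M (sym_diff a B) < e" by blast
    moreover have "sym_diff (space M - a) (space M - B) = sym_diff a B"
      using sets.sets_into_space[OF meas[OF Compl.hyps]] B(1) G(2) sets.sets_into_space by blast
    ultimately show ?case by (intro bexI[of _ "space M - B"]) auto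
  next
    case (Union a)
    \<comment> \<open>These errors sum to \<open>e/2\<close>, and cutting the union off at
      \<open>n\<close> loses at most another \<open>e/4\<close>, so the total stays strictly below
      \<open>e\<close>.\<close>
    have "\<exists>B\<in>\<A>. measure M (sym_diff (a i) B) < e/4 * (1/2)^i" for i
      using Union.IH[of "e/4 * (1/2)^i" i] Union.prems by simp
    then obtain B where B: "\<And>i. B i \<in> \<A>" "\<And>i. measure M (sym_diff (a i) (B i)) < e/4 * (1/2)^i"
      by metis
    have am [measurable]: "a i \<in> sets M" "B i \<in> sets M" for i
      using meas[OF Union.hyps(1)] B(1) G(2) by auto
    have "(\<lambda>n. measure M (\<Union>i<n. a i)) \<longlonglongrightarrow> measure M (\<Union>n. \<Union>i<n. a i)"
      by (intro finite_Lim_measure_incseq) (auto simp: incseq_def intro: less_le_trans)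
    moreover have U: "(\<Union>n. \<Union>i<n. a i) = (\<Union>i. a i)" by auto
    ultimately have "eventually (\<lambda>n. measure M (\<Union>i<n. a i) > measure M (\<Union>i. a i) - e/4) sequentially"
      using Union.prems by (intro order_tendstoD(1)) auto
    then obtain n where n: "measure M (\<Union>i<n. a i) > measure M (\<Union>i. a i) - e/4"
      by (auto simp: eventually_sequentially)
    have "sym_diff (\<Union>i. a i) (\<Union>i<n. B i)
        \<subseteq> ((\<Union>i. a i) - (\<Union>i<n. a i)) \<union> (\<Union>i<n. sym_diff (a i) (B i))" by blast
    then have "measure M (sym_diff (\<Union>i. a i) (\<Union>i<n. B i))
        \<le> measure M (((\<Union>i. a i) - (\<Union>i<n. a i)) \<union> (\<Union>i<n. sym_diff (a i) (B i)))"
      by (intro finite_measure_mono) auto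
    also have "\<dots> \<le> measure M ((\<Union>i. a i) - (\<Union>i<n. a i)) + measure M (\<Union>i<n. sym_diff (a i) (B i))"
      by (intro measure_Un_le) auto
    also have "measure M ((\<Union>i. a i) - (\<Union>i<n. a i)) \<le> e/4"
      using n by (subst finite_measure_Diff) auto
    also have "measure M (\<Union>i<n. sym_diff (a i) (B i)) \<le> (\<Sum>i<n. measure M (sym_diff (a i) (B i)))"
      by (intro finite_measure_subadditive_finite) auto
    also have "\<dots> \<le> (\<Sum>i<n. e/4 * (1/2)^i)"
      by (intro sum_mono less_imp_le B)
    also have "\<dots> \<le> (\<Sum>i. e/4 * (1/2)^i)"
      using Union.prems by (intro sum_le_suminf summable_mult summable_geometric) auto
    also have "\<dots> = e/2"
      by (subst suminf_mult) (auto simp: suminf_geometric summable_geometric)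
    finally have "measure M (sym_diff (\<Union>i. a i) (\<Union>i<n. B i)) < e"
      using Union.prems by simp
    then show ?case using B by (intro bexI[of _ "\<Union>i<n. B i"]) auto
  qed
qed

section \<open>Count and past \<open>\<sigma>\<close>-fields\<close>

lemma space_count_sigma [simp]: "space (count_sigma M N I) = space M"
  by (simp add: count_sigma_def space_measure_of_conv)

lemma sets_count_sigma:
  "sets (count_sigma M N I) = sigma_sets (space M) {N s -` B \<inter> space M | s B. s \<in> I}"
  by (subst count_sigma_def, rule sets_measure_of) auto

lemma measurable_count_sigma:
  assumes "s \<in> I" shows "N s \<in> count_sigma M N I \<rightarrow>\<^sub>M count_space UNIV"
  using assms by (intro measurableI) (auto simp: sets_count_sigma)

lemma sets_count_sigma_subset:
  assumes "sigma_algebra (space M) S" "\<And>s. s \<in> I \<Longrightarrow> \<forall>B. N s -` B \<inter> space M \<in> S"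
  shows "sets (count_sigma M N I) \<subseteq> S"
  unfolding sets_count_sigma
  by (rule sigma_algebra.sigma_sets_subset[OF assms(1)]) (use assms(2) in auto)

lemma sets_count_sigma_mono: "I \<subseteq> J \<Longrightarrow> sets (count_sigma M N I) \<subseteq> sets (count_sigma M N J)"
  unfolding sets_count_sigma by (intro sigma_sets_mono' Collect_mono impI) blast

lemma space_past_sigma [simp]: "space (past_sigma M N lam t) = space M"
  by (simp add: past_sigma_def space_measure_of_conv)

lemma sets_past_sigma:
  "sets (past_sigma M N lam t) = sigma_sets (space M)
     ({N s -` B \<inter> space M | s B. s \<le> t} \<union> {lam s -` B \<inter> space M | s B. s \<le> t \<and> B \<in> sets borel})"
  by (subst past_sigma_def, rule sets_measure_of) auto

lemma sets_past_sigma_mono: "s \<le> t \<Longrightarrow> sets (past_sigma M N lam s) \<subseteq> sets (past_sigma M N lam t)"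
  unfolding sets_past_sigma by (intro sigma_sets_mono' Un_mono) (blast intro: order_trans)+

lemma space_path_space [simp]: "space path_space = UNIV"
  by (simp add: path_space_def space_PiM space_pair_measure)

section \<open>The stationary chain and its one-step transition\<close>

locale contractive_poisson_process = prob_space M
  for M :: "'a measure" +
  fixes N :: "int \<Rightarrow> 'a \<Rightarrow> nat"
    and lam :: "int \<Rightarrow> 'a \<Rightarrow> real"
    and f :: "real \<Rightarrow> nat \<Rightarrow> real"
    and \<kappa>\<^sub>1 \<kappa>\<^sub>2 :: real
  assumes f_nonneg: "\<And>x y. x \<ge> 0 \<Longrightarrow> f x y \<ge> 0"
    and f_lip: "\<And>x x' y y'. x \<ge> 0 \<Longrightarrow> x' \<ge> 0 \<Longrightarrow>
          \<bar>f x y - f x' y'\<bar> \<le> \<kappa>\<^sub>1 * \<bar>x - x'\<bar> + \<kappa>\<^sub>2 * \<bar>real y - real y'\<bar>"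
    and k1_nonneg: "\<kappa>\<^sub>1 \<ge> 0" and k2_nonneg: "\<kappa>\<^sub>2 \<ge> 0" and contractive: "\<kappa>\<^sub>1 + \<kappa>\<^sub>2 < 1"
    and N_meas [measurable]: "\<And>t. N t \<in> measurable M (count_space UNIV)"
    and lam_meas [measurable]: "\<And>t. lam t \<in> borel_measurable M"
    and lam_nonneg: "\<And>t \<omega>. \<omega> \<in> space M \<Longrightarrow> lam t \<omega> \<ge> 0"
    and stat: "strictly_stationary M N lam"
    and poisson: "\<And>t k. AE \<omega> in M.
          real_cond_exp M (past_sigma M N lam (t - 1)) (indicator {\<omega>\<in>space M. N t \<omega> = k}) \<omega>
            = exp (- lam t \<omega>) * lam t \<omega> ^ k / fact k"
    and recursion: "\<And>t \<omega>. \<omega> \<in> space M \<Longrightarrow> lam t \<omega> = f (lam (t - 1) \<omega>) (N (t - 1) \<omega>)"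
begin

abbreviation past :: "int \<Rightarrow> 'a measure" where "past t \<equiv> past_sigma M N lam t"

text \<open>Composing with \<open>max 0\<close> extends \<open>f\<close> to all real intensities
  with the same Lipschitz constants, so that versions can be Lipschitz on all of \<open>UNIV\<close>
  without sign conditions.\<close>

definition step :: "real \<Rightarrow> nat \<Rightarrow> real" where "step x k = f (max 0 x) k"

lemma step_nonneg [simp]: "0 \<le> step x k"
  by (simp add: step_def f_nonneg)

lemma step_lip: "\<bar>step x k - step y l\<bar> \<le> \<kappa>\<^sub>1 * \<bar>x - y\<bar> + \<kappa>\<^sub>2 * \<bar>real k - real l\<bar>"
proof -
  have "\<bar>step x k - step y l\<bar> \<le> \<kappa>\<^sub>1 * \<bar>max 0 x - max 0 y\<bar> + \<kappa>\<^sub>2 * \<bar>real k - real l\<bar>"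
    unfolding step_def by (rule f_lip) auto
  also have "\<dots> \<le> \<kappa>\<^sub>1 * \<bar>x - y\<bar> + \<kappa>\<^sub>2 * \<bar>real k - real l\<bar>"
    by (intro add_right_mono mult_left_mono k1_nonneg) auto
  finally show ?thesis .
qed

lemma lam_step: "\<omega> \<in> space M \<Longrightarrow> lam (t + 1) \<omega> = step (lam t \<omega>) (N t \<omega>)"
  using recursion[of \<omega> "t + 1"] lam_nonneg[of \<omega> t] by (simp add: step_def max_def)

lemma borel_measurable_step [measurable]: "(\<lambda>x. step x k) \<in> borel_measurable borel"
proof -
  have "\<kappa>\<^sub>1-lipschitz_on UNIV (\<lambda>x. step x k)"
    using step_lip[of _ k _ k] k1_nonneg by (intro lipschitz_onI) (auto simp: dist_real_def)
  then show ?thesis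
    by (intro borel_measurable_continuous_onI lipschitz_on_continuous_on)
qed

lemma measurable_step [measurable (raw)]:
  assumes "g \<in> borel_measurable L" and "K \<in> L \<rightarrow>\<^sub>M count_space UNIV"
  shows "(\<lambda>w. step (g w) (K w)) \<in> borel_measurable L"
  by (rule measurable_compose_countable[where f = "\<lambda>k w. step (g w) k"])
    (rule measurable_compose[OF assms(1) borel_measurable_step] assms(2))+

lemma subalgebra_past: "subalgebra M (past t)"
  unfolding subalgebra_def sets_past_sigma
  by (auto intro!: sets.sigma_sets_subset)

lemma past_sets: "D \<in> sets (past t) \<Longrightarrow> D \<in> sets M"
  using subalgebra_past by (auto simp: subalgebra_def)

lemma measurable_past_M: "g \<in> past t \<rightarrow>\<^sub>M L \<Longrightarrow> g \<in> M \<rightarrow>\<^sub>M L"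
  by (rule measurable_from_subalg[OF subalgebra_past])

lemma N_past: "s \<le> t \<Longrightarrow> N s \<in> past t \<rightarrow>\<^sub>M count_space UNIV"
  by (intro measurableI) (auto simp: sets_past_sigma intro!: sigma_sets.Basic)

text \<open>The intensity is predictable: the generators only reach index \<open>t\<close>, and the
  recursion adds index \<open>t + 1\<close>. Conditioning on the past up to \<open>t - 1\<close>
  therefore already includes \<open>lam t\<close>.\<close>

lemma lam_past:
  assumes "s \<le> t + 1" shows "lam s \<in> borel_measurable (past t)"
proof -
  have *: "lam r \<in> borel_measurable (past t)" if "r \<le> t" for r
    using that by (intro measurableI) (auto simp: sets_past_sigma intro!: sigma_sets.Basic)
  show ?thesis
  proof (cases "s \<le> t")
    case False
    then have s: "s = t + 1" using assms by simp
    have [measurable]: "lam t \<in> borel_measurable (past t)" "N t \<in> past t \<rightarrow>\<^sub>M count_space UNIV"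
      by (auto intro: * N_past)
    have "(\<lambda>\<omega>. step (lam t \<omega>) (N t \<omega>)) \<in> borel_measurable (past t)"
      by measurable
    then show ?thesis
      unfolding s by (subst measurable_cong[OF lam_step]) auto
  qed (rule *)
qed

lemma sigma_finite_subalgebra_past: "sigma_finite_subalgebra M (past t)"
  by (intro finite_measure_subalgebra_is_sigma_finite finite_measure_subalgebra.intro
      finite_measure_subalgebra_axioms.intro subalgebra_past) unfold_locales

text \<open>\<open>real_cond_exp\<close> passes through \<open>enn2real\<close>, which also sends
  \<open>\<infinity>\<close> to 0. Comparison with the constant 1 excludes infinite values, so the
  Poisson weights can be lifted back to \<open>ennreal\<close>.\<close>

lemma nn_cond_exp_poisson:
  "AE \<omega> in M. nn_cond_exp M (past (t - 1)) (indicator {\<omega>\<in>space M. N t \<omega> = k}) \<omega>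
     = ennreal (poisson_weight (lam t \<omega>) k)"
proof -
  interpret P: sigma_finite_subalgebra M "past (t - 1)" by (rule sigma_finite_subalgebra_past)
  let ?A = "{\<omega>\<in>space M. N t \<omega> = k}"
  have ind: "(\<lambda>x. ennreal (indicator ?A x)) = indicator ?A"
      "(\<lambda>x. ennreal (- indicator ?A x)) = (\<lambda>_. 0)"
    by (auto simp: fun_eq_iff indicator_def ennreal_neg)
  have "AE \<omega> in M. nn_cond_exp M (past (t - 1)) (indicator ?A) \<omega> \<le> nn_cond_exp M (past (t - 1)) (\<lambda>_. 1) \<omega>"
    by (rule P.nn_cond_exp_mono) (auto simp: indicator_def)
  moreover have "AE \<omega> in M. nn_cond_exp M (past (t - 1)) (\<lambda>_. 1) \<omega> = 1"
    by (rule AE_symmetric, rule P.nn_cond_exp_F_meas) auto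
  moreover have "AE \<omega> in M. nn_cond_exp M (past (t - 1)) (\<lambda>_. 0) \<omega> = 0"
    by (rule AE_symmetric, rule P.nn_cond_exp_F_meas) auto
  ultimately show ?thesis
    using poisson[of t k]
  proof eventually_elim
    case (elim \<omega>)
    let ?c = "nn_cond_exp M (past (t - 1)) (indicator ?A) \<omega>"
    have "enn2real ?c = poisson_weight (lam t \<omega>) k"
      using elim by (simp add: real_cond_exp_def poisson_weight_def ind)
    moreover have "?c < top" using elim by (metis ennreal_one_less_top order_le_less_trans)
    ultimately show ?case by (metis ennreal_enn2real)
  qed
qed

text \<open>Once the space is split by the value of \<open>N t\<close>, each \<open>Y k\<close> is a
  past-measurable factor and can be moved through the conditional expectation of the event
  \<open>N t = k\<close>. With nonnegative integrands, sums and integrals interchange without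
  integrability conditions.\<close>

lemma nn_integral_poisson:
  assumes Y: "\<And>k. Y k \<in> borel_measurable (past (t - 1))"
  shows "(\<integral>\<^sup>+\<omega>. Y (N t \<omega>) \<omega> \<partial>M) = (\<integral>\<^sup>+\<omega>. (\<Sum>k. ennreal (poisson_weight (lam t \<omega>) k) * Y k \<omega>) \<partial>M)"
proof -
  interpret P: sigma_finite_subalgebra M "past (t - 1)" by (rule sigma_finite_subalgebra_past)
  have [measurable]: "Y k \<in> borel_measurable M" for k
    using Y by (rule measurable_past_M)
  let ?A = "\<lambda>k. {\<omega>\<in>space M. N t \<omega> = k}"
  have "(\<integral>\<^sup>+\<omega>. Y (N t \<omega>) \<omega> \<partial>M) = (\<integral>\<^sup>+\<omega>. (\<Sum>k. Y k \<omega> * indicator (?A k) \<omega>) \<partial>M)"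
    by (intro nn_integral_cong, subst suminf_cmult_indicator) (auto simp: disjoint_family_on_def)
  also have "\<dots> = (\<Sum>k. \<integral>\<^sup>+\<omega>. Y k \<omega> * indicator (?A k) \<omega> \<partial>M)"
    by (rule nn_integral_suminf) auto
  also have "\<dots> = (\<Sum>k. \<integral>\<^sup>+\<omega>. Y k \<omega> * nn_cond_exp M (past (t - 1)) (indicator (?A k)) \<omega> \<partial>M)"
    by (intro suminf_cong P.nn_cond_exp_intg[symmetric] Y) auto
  also have "\<dots> = (\<Sum>k. \<integral>\<^sup>+\<omega>. ennreal (poisson_weight (lam t \<omega>) k) * Y k \<omega> \<partial>M)"
  proof (intro suminf_cong nn_integral_cong_AE)
    show "AE \<omega> in M. Y k \<omega> * nn_cond_exp M (past (t - 1)) (indicator (?A k)) \<omega>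
        = ennreal (poisson_weight (lam t \<omega>) k) * Y k \<omega>" for k
      using nn_cond_exp_poisson[of t k] by eventually_elim (simp add: mult.commute)
  qed
  also have "\<dots> = (\<integral>\<^sup>+\<omega>. (\<Sum>k. ennreal (poisson_weight (lam t \<omega>) k) * Y k \<omega>) \<partial>M)"
    by (rule nn_integral_suminf[symmetric]) auto
  finally show ?thesis .
qed

definition path :: "'a \<Rightarrow> int \<Rightarrow> nat \<times> real" where "path \<omega> = (\<lambda>t. (N t \<omega>, lam t \<omega>))"

lemma measurable_path [measurable]: "path \<in> M \<rightarrow>\<^sub>M path_space"
  unfolding path_def path_space_def by (intro measurable_PiM_single') (auto simp: space_pair_measure)

lemma path_law_eq: "path_law M N lam = distr M path_space path"
  by (simp add: path_law_def path_def[abs_def])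

lemma measurable_shift_path [measurable]: "shift_path h \<in> path_space \<rightarrow>\<^sub>M path_space"
  unfolding shift_path_def path_space_def by (intro measurable_PiM_single') (auto simp: space_pair_measure)

lemma path_stationary: "distr M path_space (\<lambda>\<omega>. shift_path h (path \<omega>)) = distr M path_space path"
  using stat by (auto simp: strictly_stationary_def path_law_eq path_def)

lemma nn_integral_lam_stationary:
  assumes [measurable]: "g \<in> borel_measurable borel"
  shows "(\<integral>\<^sup>+\<omega>. g (lam t \<omega>) \<partial>M) = (\<integral>\<^sup>+\<omega>. g (lam s \<omega>) \<partial>M)"
proof -
  have [measurable]: "(\<lambda>x. g (snd (x 0))) \<in> borel_measurable path_space"
    unfolding path_space_def by measurable
  have "(\<integral>\<^sup>+\<omega>. g (lam t \<omega>) \<partial>M) = (\<integral>\<^sup>+\<omega>. g (lam 0 \<omega>) \<partial>M)" for t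
  proof -
    have "(\<integral>\<^sup>+\<omega>. g (lam t \<omega>) \<partial>M) = (\<integral>\<^sup>+x. g (snd (x 0)) \<partial>distr M path_space (\<lambda>\<omega>. shift_path t (path \<omega>)))"
      by (subst nn_integral_distr, measurable) (simp add: shift_path_def path_def)
    also have "\<dots> = (\<integral>\<^sup>+\<omega>. g (lam 0 \<omega>) \<partial>M)"
      unfolding path_stationary by (subst nn_integral_distr, measurable) (simp add: path_def)
    finally show ?thesis .
  qed
  from this[of t] this[of s] show ?thesis by simp
qed

section \<open>Second moment of the intensity\<close>

text \<open>The mean is not known to exist beforehand, so stationarity is applied to truncations of the two
  sides of the drift inequality.\<close>

lemma stationary_drift_integrable:
  fixes V :: "real \<Rightarrow> real"
  assumes [measurable]: "V \<in> borel_measurable borel" and V: "\<And>x. 0 \<le> V x"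
    and "0 \<le> \<rho>" "\<rho> < 1" "0 \<le> b"
    and drift: "\<And>x. 0 \<le> x \<Longrightarrow> (\<Sum>k. ennreal (poisson_weight x k) * ennreal (V (step x k))) \<le> ennreal (\<rho> * V x + b)"
  shows "integrable M (\<lambda>\<omega>. V (lam t \<omega>))"
proof -
  have trunc: "(\<integral>\<^sup>+\<omega>. ennreal (min (V (lam t \<omega>)) R) \<partial>M) \<le> (\<integral>\<^sup>+\<omega>. ennreal (min (\<rho> * V (lam t \<omega>) + b) R) \<partial>M)"
    if R: "0 \<le> R" for R
  proof -
    \<comment> \<open>On \<open>D\<close> the right-hand side is below the truncation level and the
      drift inequality applies; off \<open>D\<close> the truncated value is at most
      \<open>R\<close>. \<open>D\<close> is decided by \<open>lam t\<close>, so it is a past event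
      and can be carried through the conditioning.\<close>
    define D where "D = {\<omega> \<in> space M. \<rho> * V (lam t \<omega>) + b \<le> R}"
    have [measurable]: "lam t \<in> borel_measurable (past (t - 1))" by (rule lam_past) simp
    have "{\<omega> \<in> space (past (t - 1)). \<rho> * V (lam t \<omega>) + b \<le> R} \<in> sets (past (t - 1))"
      by measurable
    then have D [measurable]: "D \<in> sets (past (t - 1))" by (simp add: D_def)
    then have [measurable]: "D \<in> sets M" by (rule past_sets)
    have "(\<integral>\<^sup>+\<omega>. ennreal (min (V (lam t \<omega>)) R) \<partial>M) = (\<integral>\<^sup>+\<omega>. ennreal (min (V (lam (t + 1) \<omega>)) R) \<partial>M)"
      by (rule nn_integral_lam_stationary) measurable
    also have "\<dots> \<le> (\<integral>\<^sup>+\<omega>. indicator D \<omega> * ennreal (V (lam (t + 1) \<omega>)) + indicator (space M - D) \<omega> * ennreal R \<partial>M)"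
      by (intro nn_integral_mono) (auto simp: indicator_def intro!: ennreal_leI)
    also have "\<dots> = (\<integral>\<^sup>+\<omega>. indicator D \<omega> * ennreal (V (lam (t + 1) \<omega>)) \<partial>M) + (\<integral>\<^sup>+\<omega>. indicator (space M - D) \<omega> * ennreal R \<partial>M)"
      by (intro nn_integral_add) measurable
    also have "(\<integral>\<^sup>+\<omega>. indicator D \<omega> * ennreal (V (lam (t + 1) \<omega>)) \<partial>M)
        = (\<integral>\<^sup>+\<omega>. indicator D \<omega> * ennreal (V (step (lam t \<omega>) (N t \<omega>))) \<partial>M)"
      by (intro nn_integral_cong) (simp add: lam_step)
    also have "\<dots> = (\<integral>\<^sup>+\<omega>. (\<Sum>k. ennreal (poisson_weight (lam t \<omega>) k) * (indicator D \<omega> * ennreal (V (step (lam t \<omega>) k)))) \<partial>M)"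
      by (rule nn_integral_poisson[where Y = "\<lambda>k \<omega>. indicator D \<omega> * ennreal (V (step (lam t \<omega>) k))"]) measurable
    also have "\<dots> = (\<integral>\<^sup>+\<omega>. indicator D \<omega> * (\<Sum>k. ennreal (poisson_weight (lam t \<omega>) k) * ennreal (V (step (lam t \<omega>) k))) \<partial>M)"
      by (simp add: mult.left_commute)
    also have "\<dots> \<le> (\<integral>\<^sup>+\<omega>. indicator D \<omega> * ennreal (\<rho> * V (lam t \<omega>) + b) \<partial>M)"
      by (intro nn_integral_mono mult_left_mono drift lam_nonneg) auto
    also have "(\<integral>\<^sup>+\<omega>. indicator D \<omega> * ennreal (\<rho> * V (lam t \<omega>) + b) \<partial>M) + (\<integral>\<^sup>+\<omega>. indicator (space M - D) \<omega> * ennreal R \<partial>M)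
        = (\<integral>\<^sup>+\<omega>. indicator D \<omega> * ennreal (\<rho> * V (lam t \<omega>) + b) + indicator (space M - D) \<omega> * ennreal R \<partial>M)"
      by (intro nn_integral_add[symmetric]) measurable
    also have "\<dots> = (\<integral>\<^sup>+\<omega>. ennreal (min (\<rho> * V (lam t \<omega>) + b) R) \<partial>M)"
      by (intro nn_integral_cong) (auto simp: D_def indicator_def min_def)
    finally show ?thesis by (simp add: add_right_mono)
  qed
  have bound: "(\<integral>\<^sup>+\<omega>. ennreal (V (lam t \<omega>)) * indicator {\<omega>. V (lam t \<omega>) \<le> real n} \<omega> \<partial>M) \<le> ennreal (b / (1 - \<rho>))" for n
  proof -
    define U where "U \<omega> = V (lam t \<omega>) * indicator {\<omega>. V (lam t \<omega>) \<le> real n} \<omega>" for \<omega>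
    have [measurable]: "U \<in> borel_measurable M" unfolding U_def by measurable
    have U: "0 \<le> U \<omega>" "U \<omega> \<le> n" for \<omega> by (auto simp: U_def V indicator_def)
    have int: "integrable M U"
      by (rule integrable_const_bound[of _ "real n"]) (use U in auto)
    have int2: "integrable M (\<lambda>\<omega>. min (V (lam t \<omega>)) (real n))"
      "integrable M (\<lambda>\<omega>. min (\<rho> * V (lam t \<omega>) + b) (real n))"
      by (auto intro!: integrable_const_bound[of _ "real n"] simp: V \<open>0 \<le> \<rho>\<close> \<open>0 \<le> b\<close>)
    have "(\<integral>\<omega>. min (V (lam t \<omega>)) (real n) \<partial>M) \<le> (\<integral>\<omega>. min (\<rho> * V (lam t \<omega>) + b) (real n) \<partial>M)"
      using trunc[of "real n"] int2 \<open>0 \<le> \<rho>\<close> \<open>0 \<le> b\<close> V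
      by (simp add: nn_integral_eq_integral integral_nonneg_AE)
    \<comment> \<open>Where \<open>V\<close> is at most \<open>n\<close>, the new integrand equals
      \<open>\<rho> * V + b\<close>; elsewhere \<open>U\<close> vanishes and the truncated
      \<open>V\<close> is already \<open>n\<close>. The truncated expectation is finite, so it
      cancels from both ends of the chain.\<close>
    also have "\<dots> \<le> (\<integral>\<omega>. min (V (lam t \<omega>)) (real n) + (b - (1 - \<rho>) * U \<omega>) \<partial>M)"
    proof (intro integral_mono int2 Bochner_Integration.integrable_add Bochner_Integration.integrable_diff integrable_mult_right int integrable_const)
      show "min (\<rho> * V (lam t \<omega>) + b) (real n) \<le> min (V (lam t \<omega>)) (real n) + (b - (1 - \<rho>) * U \<omega>)" for \<omega>
        using \<open>0 \<le> b\<close> by (auto simp: U_def indicator_def algebra_simps min_def)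
    qed
    also have "\<dots> = (\<integral>\<omega>. min (V (lam t \<omega>)) (real n) \<partial>M) + (b - (1 - \<rho>) * (\<integral>\<omega>. U \<omega> \<partial>M))"
      using int int2 by (simp add: prob_space)
    finally have "(\<integral>\<omega>. U \<omega> \<partial>M) \<le> b / (1 - \<rho>)"
      using \<open>\<rho> < 1\<close> by (simp add: field_simps)
    then have "(\<integral>\<^sup>+\<omega>. ennreal (U \<omega>) \<partial>M) \<le> ennreal (b / (1 - \<rho>))"
      by (subst nn_integral_eq_integral[OF int]) (auto simp: U intro: ennreal_leI)
    moreover have "ennreal (U \<omega>) = ennreal (V (lam t \<omega>)) * indicator {\<omega>. V (lam t \<omega>) \<le> real n} \<omega>" for \<omega>
      by (auto simp: U_def indicator_def)
    ultimately show ?thesis by simp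
  qed
  have "(\<integral>\<^sup>+\<omega>. ennreal (V (lam t \<omega>)) \<partial>M)
      = (\<integral>\<^sup>+\<omega>. (SUP n. ennreal (V (lam t \<omega>)) * indicator {\<omega>. V (lam t \<omega>) \<le> real n} \<omega>) \<partial>M)"
  proof (intro nn_integral_cong antisym SUP_least)
    fix \<omega>
    obtain n where "V (lam t \<omega>) \<le> real n" using real_arch_simple by blast
    then show "ennreal (V (lam t \<omega>)) \<le> (SUP n. ennreal (V (lam t \<omega>)) * indicator {\<omega>. V (lam t \<omega>) \<le> real n} \<omega>)"
      by (intro SUP_upper2[of n]) (auto simp: indicator_def)
  qed (auto simp: indicator_def)
  also have "\<dots> = (SUP n. \<integral>\<^sup>+\<omega>. ennreal (V (lam t \<omega>)) * indicator {\<omega>. V (lam t \<omega>) \<le> real n} \<omega> \<partial>M)"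
    by (intro nn_integral_monotone_convergence_SUP) (auto simp: incseq_def le_fun_def indicator_def)
  also have "\<dots> \<le> ennreal (b / (1 - \<rho>))"
    by (intro SUP_least bound)
  finally show ?thesis
    by (intro integrableI_bounded) (auto simp: V intro: le_less_trans)
qed

lemma step_le: "0 \<le> x \<Longrightarrow> step x k \<le> step 0 0 + \<kappa>\<^sub>1 * x + \<kappa>\<^sub>2 * real k"
  using step_lip[of x k 0 0] by simp

text \<open>Squaring the affine bound on \<open>step\<close> and inserting the Poisson moments gives
  the leading coefficient \<open>\<kappa>\<^sup>2\<close>, which is below 1; the variance of the
  count adds only a term linear in \<open>x\<close>. So \<open>x\<^sup>2\<close> satisfies a drift
  inequality.\<close>

lemma integrable_lam_square: "integrable M (\<lambda>\<omega>. (lam t \<omega>)\<^sup>2)"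
proof -
  define \<kappa> where "\<kappa> = \<kappa>\<^sub>1 + \<kappa>\<^sub>2"
  define c where "c = step 0 0"
  \<comment> \<open>\<open>d\<close> is the coefficient of \<open>x\<close> in the second moment of
    the affine bound. Half of the gap \<open>1 - \<kappa>\<^sup>2\<close> is set aside as
    \<open>\<eta>\<close> to absorb \<open>d * x\<close> by completing the square, which leaves
    \<open>\<kappa>\<^sup>2 + \<eta> < 1\<close>.\<close>
  define d where "d = 2 * c * \<kappa> + \<kappa>\<^sub>2\<^sup>2"
  define \<eta> where "\<eta> = (1 - \<kappa>\<^sup>2) / 2"
  have \<kappa>: "0 \<le> \<kappa>" "\<kappa> < 1" using k1_nonneg k2_nonneg contractive by (auto simp: \<kappa>_def)
  then have \<kappa>2: "\<kappa>\<^sup>2 < 1" by (simp add: power_less_one_iff abs_square_less_1)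
  then have \<eta>: "0 < \<eta>" by (simp add: \<eta>_def)
  have c: "0 \<le> c" by (simp add: c_def)
  show ?thesis
  proof (rule stationary_drift_integrable[where V = "\<lambda>x. x\<^sup>2" and \<rho> = "\<kappa>\<^sup>2 + \<eta>" and b = "c\<^sup>2 + d\<^sup>2 / (4 * \<eta>)"])
    fix x :: real assume x: "0 \<le> x"
    have s: "(\<lambda>k. poisson_weight x k * (c + \<kappa>\<^sub>1 * x + \<kappa>\<^sub>2 * real k)\<^sup>2) sums
        ((c + \<kappa>\<^sub>1 * x)\<^sup>2 * 1 + 2 * (c + \<kappa>\<^sub>1 * x) * \<kappa>\<^sub>2 * x + \<kappa>\<^sub>2\<^sup>2 * (x\<^sup>2 + x))"
    proof -
      have "(\<lambda>k. (c + \<kappa>\<^sub>1 * x)\<^sup>2 * poisson_weight x k + 2 * (c + \<kappa>\<^sub>1 * x) * \<kappa>\<^sub>2 * (poisson_weight x k * real k)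
          + \<kappa>\<^sub>2\<^sup>2 * (poisson_weight x k * (real k)\<^sup>2)) sums
        ((c + \<kappa>\<^sub>1 * x)\<^sup>2 * 1 + 2 * (c + \<kappa>\<^sub>1 * x) * \<kappa>\<^sub>2 * x + \<kappa>\<^sub>2\<^sup>2 * (x\<^sup>2 + x))"
        by (intro sums_add sums_mult poisson_weight_sums poisson_mean_sums poisson_second_moment_sums)
      moreover have "poisson_weight x k * (c + \<kappa>\<^sub>1 * x + \<kappa>\<^sub>2 * real k)\<^sup>2 =
          (c + \<kappa>\<^sub>1 * x)\<^sup>2 * poisson_weight x k + 2 * (c + \<kappa>\<^sub>1 * x) * \<kappa>\<^sub>2 * (poisson_weight x k * real k)
          + \<kappa>\<^sub>2\<^sup>2 * (poisson_weight x k * (real k)\<^sup>2)" for k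
        unfolding power2_sum[of "c + \<kappa>\<^sub>1 * x"] by (simp add: algebra_simps power2_eq_square)
      ultimately show ?thesis by simp
    qed
    have "(\<Sum>k. ennreal (poisson_weight x k) * ennreal ((step x k)\<^sup>2))
        \<le> (\<Sum>k. ennreal (poisson_weight x k * (c + \<kappa>\<^sub>1 * x + \<kappa>\<^sub>2 * real k)\<^sup>2))"
    proof (intro suminf_le summableI)
      fix k
      have "(step x k)\<^sup>2 \<le> (c + \<kappa>\<^sub>1 * x + \<kappa>\<^sub>2 * real k)\<^sup>2"
        using step_le[OF x, of k] by (intro power_mono) (auto simp: c_def)
      then show "ennreal (poisson_weight x k) * ennreal ((step x k)\<^sup>2)
          \<le> ennreal (poisson_weight x k * (c + \<kappa>\<^sub>1 * x + \<kappa>\<^sub>2 * real k)\<^sup>2)"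
        using x by (simp flip: ennreal_mult add: mult_left_mono ennreal_leI)
    qed
    also have "\<dots> = ennreal ((c + \<kappa>\<^sub>1 * x)\<^sup>2 * 1 + 2 * (c + \<kappa>\<^sub>1 * x) * \<kappa>\<^sub>2 * x + \<kappa>\<^sub>2\<^sup>2 * (x\<^sup>2 + x))"
      using x by (intro suminf_ennreal_eq s) auto
    also have "\<dots> \<le> ennreal ((\<kappa>\<^sup>2 + \<eta>) * x\<^sup>2 + (c\<^sup>2 + d\<^sup>2 / (4 * \<eta>)))"
    proof (rule ennreal_leI)
      have "0 \<le> (2 * \<eta> * x - d)\<^sup>2 / (4 * \<eta>)" using \<eta> by simp
      also have "\<dots> = \<eta> * x\<^sup>2 - d * x + d\<^sup>2 / (4 * \<eta>)"
        using \<eta> by (simp add: power2_diff field_simps power2_eq_square)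
      finally have "d * x \<le> \<eta> * x\<^sup>2 + d\<^sup>2 / (4 * \<eta>)" by simp
      moreover have "(c + \<kappa>\<^sub>1 * x)\<^sup>2 * 1 + 2 * (c + \<kappa>\<^sub>1 * x) * \<kappa>\<^sub>2 * x + \<kappa>\<^sub>2\<^sup>2 * (x\<^sup>2 + x)
          = \<kappa>\<^sup>2 * x\<^sup>2 + d * x + c\<^sup>2"
        by (simp add: d_def \<kappa>_def power2_eq_square algebra_simps)
      ultimately show "(c + \<kappa>\<^sub>1 * x)\<^sup>2 * 1 + 2 * (c + \<kappa>\<^sub>1 * x) * \<kappa>\<^sub>2 * x + \<kappa>\<^sub>2\<^sup>2 * (x\<^sup>2 + x)
          \<le> (\<kappa>\<^sup>2 + \<eta>) * x\<^sup>2 + (c\<^sup>2 + d\<^sup>2 / (4 * \<eta>))"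
        by (simp add: algebra_simps)
    qed
    finally show "(\<Sum>k. ennreal (poisson_weight x k) * ennreal ((step x k)\<^sup>2))
        \<le> ennreal ((\<kappa>\<^sup>2 + \<eta>) * x\<^sup>2 + (c\<^sup>2 + d\<^sup>2 / (4 * \<eta>)))" .
  next
    show "\<kappa>\<^sup>2 + \<eta> < 1" using \<kappa>2 by (simp add: \<eta>_def field_simps)
  qed (use \<eta> in auto)
qed

lemma integrable_lam: "integrable M (lam t)"
  by (rule square_integrable_imp_integrable[OF lam_meas integrable_lam_square])

lemma expectation_lam: "(\<integral>\<omega>. lam t \<omega> \<partial>M) = (\<integral>\<omega>. lam s \<omega> \<partial>M)"
proof -
  have "(\<integral>\<^sup>+\<omega>. ennreal (lam t \<omega>) \<partial>M) = (\<integral>\<^sup>+\<omega>. ennreal (lam s \<omega>) \<partial>M)"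
    by (rule nn_integral_lam_stationary) measurable
  then show ?thesis
    using integral_eq_nn_integral[of "lam t" M] integral_eq_nn_integral[of "lam s" M] by (simp add: lam_nonneg AE_I2)
qed

section \<open>Intensity as a function of the past counts\<close>

text \<open>The argument lists the counts backwards in time, the most recent one being \<open>x 0\<close>.\<close>

primrec recon :: "nat \<Rightarrow> (nat \<Rightarrow> nat) \<Rightarrow> real" where
  "recon 0 x = 0"
| "recon (Suc m) x = step (recon m (\<lambda>i. x (Suc i))) (x 0)"

lemma borel_measurable_recon [measurable]:
  "recon m \<in> borel_measurable (PiM UNIV (\<lambda>_. count_space UNIV))"
proof (induction m)
  case (Suc m)
  have sh: "(\<lambda>x i. x (Suc i)) \<in> PiM UNIV (\<lambda>_. count_space UNIV) \<rightarrow>\<^sub>M PiM UNIV (\<lambda>_. count_space UNIV)"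
    by (intro measurable_PiM_single') auto
  have [measurable]: "(\<lambda>x. x 0) \<in> PiM UNIV (\<lambda>_::nat. count_space UNIV) \<rightarrow>\<^sub>M count_space (UNIV :: nat set)"
    by (rule measurable_component_singleton) simp
  have "(\<lambda>x. recon m (\<lambda>i. x (Suc i))) \<in> borel_measurable (PiM UNIV (\<lambda>_. count_space UNIV))"
    using measurable_compose[OF sh Suc.IH] by simp
  then show ?case by simp measurable
qed simp

text \<open>The true intensity and the recursion started at 0 are driven by the same counts, so only
  the \<open>\<kappa>\<^sub>1\<close> part of the Lipschitz bound acts, and the initial error is the
  intensity \<open>m\<close> steps back.\<close>

lemma recon_approximates:
  assumes "\<omega> \<in> space M"
  shows "\<bar>lam t \<omega> - recon m (\<lambda>i. N (t - 1 - int i) \<omega>)\<bar> \<le> \<kappa>\<^sub>1 ^ m * lam (t - int m) \<omega>"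
proof (induction m arbitrary: t)
  case 0 then show ?case using lam_nonneg[OF assms] by simp
next
  case (Suc m)
  have "lam t \<omega> = step (lam (t - 1) \<omega>) (N (t - 1) \<omega>)"
    using lam_step[OF assms, of "t - 1"] by simp
  then have "\<bar>lam t \<omega> - recon (Suc m) (\<lambda>i. N (t - 1 - int i) \<omega>)\<bar>
      \<le> \<kappa>\<^sub>1 * \<bar>lam (t - 1) \<omega> - recon m (\<lambda>i. N (t - 1 - 1 - int i) \<omega>)\<bar>"
    using step_lip[of "lam (t - 1) \<omega>" "N (t - 1) \<omega>" "recon m (\<lambda>i. N (t - 1 - 1 - int i) \<omega>)" "N (t - 1) \<omega>"]
    by (simp add: algebra_simps)
  also have "\<dots> \<le> \<kappa>\<^sub>1 * (\<kappa>\<^sub>1 ^ m * lam (t - 1 - int m) \<omega>)"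
    by (intro mult_left_mono Suc.IH k1_nonneg)
  finally show ?case by (simp add: algebra_simps)
qed

text \<open>\<open>lim\<close> has an unspecified value where the recursion does not converge;
  \<open>max 0\<close> keeps the function nonnegative there too.\<close>

definition intensity :: "(nat \<Rightarrow> nat) \<Rightarrow> real" where
  "intensity x = max 0 (lim (\<lambda>m. recon m x))"

lemma borel_measurable_intensity [measurable]:
  "intensity \<in> borel_measurable (PiM UNIV (\<lambda>_. count_space UNIV))"
  unfolding intensity_def by measurable

lemma intensity_nonneg: "0 \<le> intensity x"
  by (simp add: intensity_def)

lemma k1_less_1: "\<kappa>\<^sub>1 < 1" using k2_nonneg contractive by simp

text \<open>By stationarity all terms \<open>lam (t - int m)\<close> have the same finite mean, so
  the error bounds have a finite expected sum. Almost surely they are summable and hence tend to 0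
  along the full sequence.\<close>

lemma lam_eq_intensity: "AE \<omega> in M. lam t \<omega> = intensity (\<lambda>i. N (t - 1 - int i) \<omega>)"
proof -
  define E where "E = (\<integral>\<omega>. lam 0 \<omega> \<partial>M)"
  have E: "(\<integral>\<^sup>+\<omega>. ennreal (lam s \<omega>) \<partial>M) = ennreal E" for s
    using nn_integral_eq_integral[OF integrable_lam, of s] expectation_lam[of s 0]
    by (simp add: lam_nonneg AE_I2 E_def)
  have "(\<integral>\<^sup>+\<omega>. (\<Sum>m. ennreal (\<kappa>\<^sub>1 ^ m * lam (t - int m) \<omega>)) \<partial>M) = (\<Sum>m. \<integral>\<^sup>+\<omega>. ennreal (\<kappa>\<^sub>1 ^ m * lam (t - int m) \<omega>) \<partial>M)"
    by (rule nn_integral_suminf) measurable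
  also have "\<dots> = (\<Sum>m. ennreal (\<kappa>\<^sub>1 ^ m) * ennreal E)"
    by (simp add: ennreal_mult' k1_nonneg nn_integral_cmult E)
  also have "\<dots> = (\<Sum>m. ennreal (\<kappa>\<^sub>1 ^ m)) * ennreal E" by simp
  also have "\<dots> < \<infinity>"
    using k1_nonneg k1_less_1 by (simp add: suminf_ennreal_eq[OF _ geometric_sums] ennreal_mult_less_top)
  finally have "AE \<omega> in M. (\<Sum>m. ennreal (\<kappa>\<^sub>1 ^ m * lam (t - int m) \<omega>)) \<noteq> \<infinity>"
    by (intro nn_integral_noteq_infinite) auto
  then show ?thesis
  proof (rule AE_mp, intro AE_I2 impI)
    fix \<omega> assume \<omega>: "\<omega> \<in> space M" and fin: "(\<Sum>m. ennreal (\<kappa>\<^sub>1 ^ m * lam (t - int m) \<omega>)) \<noteq> \<infinity>"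
    have "summable (\<lambda>m. \<kappa>\<^sub>1 ^ m * lam (t - int m) \<omega>)"
      using fin by (intro summable_suminf_not_top) (auto simp: k1_nonneg lam_nonneg \<omega>)
    then have "(\<lambda>m. \<kappa>\<^sub>1 ^ m * lam (t - int m) \<omega>) \<longlonglongrightarrow> 0" by (rule summable_LIMSEQ_zero)
    then have "(\<lambda>m. lam t \<omega> - recon m (\<lambda>i. N (t - 1 - int i) \<omega>)) \<longlonglongrightarrow> 0"
      by (rule Lim_null_comparison[rotated]) (auto simp: recon_approximates \<omega>)
    from tendsto_diff[OF tendsto_const[of "lam t \<omega>"] this]
    have "(\<lambda>m. recon m (\<lambda>i. N (t - 1 - int i) \<omega>)) \<longlonglongrightarrow> lam t \<omega>" by simp
    then show "lam t \<omega> = intensity (\<lambda>i. N (t - 1 - int i) \<omega>)"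
      using lam_nonneg[OF \<omega>] by (simp add: intensity_def limI max_def)
  qed
qed

section \<open>Lipschitz versions of conditional probabilities\<close>

lemma lam_past_pred [measurable]: "lam t \<in> borel_measurable (past (t - 1))"
  by (rule lam_past) simp

text \<open>Here \<open>p (lam t)\<close> is a version of the conditional probability of \<open>A\<close> given the past before \<open>t\<close>.\<close>

definition version :: "int \<Rightarrow> real set \<Rightarrow> real \<Rightarrow> 'a set \<Rightarrow> (real \<Rightarrow> real) \<Rightarrow> bool" where
  "version t S c A p \<longleftrightarrow> p \<in> borel_measurable borel \<and> (\<forall>x. 0 \<le> p x \<and> p x \<le> 1) \<and> c-lipschitz_on S p \<and>
     (\<forall>D\<in>sets (past (t - 1)). measure M (A \<inter> D) = (\<integral>\<omega>. indicator D \<omega> * p (lam t \<omega>) \<partial>M))"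

lemma versionD:
  assumes "version t S c A p"
  shows "p \<in> borel_measurable borel" "0 \<le> p x" "p x \<le> 1" "c-lipschitz_on S p"
    "D \<in> sets (past (t - 1)) \<Longrightarrow> measure M (A \<inter> D) = (\<integral>\<omega>. indicator D \<omega> * p (lam t \<omega>) \<partial>M)"
  using assms by (auto simp: version_def)

lemma version_mono: "version t S c A p \<Longrightarrow> S' \<subseteq> S \<Longrightarrow> c \<le> c' \<Longrightarrow> version t S' c' A p"
  unfolding version_def by (blast intro: lipschitz_on_mono)

lemma integrable_indicator_bounded:
  assumes "D \<in> sets M" "p \<in> borel_measurable borel" "\<And>x. 0 \<le> p x \<and> p x \<le> (1::real)"
  shows "integrable M (\<lambda>\<omega>. indicator D \<omega> * p (lam t \<omega>))"
  using assms by (intro integrable_const_bound[of _ 1]) (auto simp: indicator_def)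

lemma version_integral_iff:
  assumes "D \<in> sets M" "p \<in> borel_measurable borel" "\<And>x. 0 \<le> p x \<and> p x \<le> 1"
  shows "measure M (A \<inter> D) = (\<integral>\<omega>. indicator D \<omega> * p (lam t \<omega>) \<partial>M) \<longleftrightarrow>
    emeasure M (A \<inter> D) = (\<integral>\<^sup>+\<omega>. indicator D \<omega> * ennreal (p (lam t \<omega>)) \<partial>M)"
proof -
  have "(\<integral>\<^sup>+\<omega>. indicator D \<omega> * ennreal (p (lam t \<omega>)) \<partial>M) = (\<integral>\<^sup>+\<omega>. ennreal (indicator D \<omega> * p (lam t \<omega>)) \<partial>M)"
    by (intro nn_integral_cong) (auto simp: indicator_def)
  also have "\<dots> = ennreal (\<integral>\<omega>. indicator D \<omega> * p (lam t \<omega>) \<partial>M)"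
    by (intro nn_integral_eq_integral integrable_indicator_bounded assms) (use assms in auto)
  finally show ?thesis
    using assms(3) by (simp add: emeasure_eq_measure integral_nonneg_AE)
qed

lemma version_nn_integral:
  assumes "version t S c A p" "D \<in> sets (past (t - 1))"
  shows "emeasure M (A \<inter> D) = (\<integral>\<^sup>+\<omega>. indicator D \<omega> * ennreal (p (lam t \<omega>)) \<partial>M)"
  using assms version_integral_iff[of D p A t] past_sets by (auto simp: version_def)

text \<open>The change from \<open>x\<close> to \<open>y\<close> is made in two moves: inside
  \<open>step\<close> with the Poisson weights fixed, which costs
  \<open>\<kappa>\<^sub>1 * c\<close>, and then in the weights with the values fixed, which costs
  the bound \<open>L\<close> on the forward difference.\<close>

lemma poisson_transition_lipschitz:
  assumes \<phi>: "\<And>k x. 0 \<le> \<phi> k x \<and> \<phi> k x \<le> 1" "\<And>k. c-lipschitz_on UNIV (\<phi> k)"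
    and L: "\<And>k x. \<bar>\<phi> (Suc k) (step x (Suc k)) - \<phi> k (step x k)\<bar> \<le> L"
  shows "(\<kappa>\<^sub>1 * c + L)-lipschitz_on UNIV (\<lambda>x. \<Sum>k. poisson_weight (max 0 x) k * \<phi> k (step x k))"
proof (rule lipschitz_onI)
  have "0 \<le> c" using \<phi>(2) by (rule lipschitz_on_nonneg)
  moreover have "0 \<le> L" using L[of 0 0] by linarith
  ultimately show "0 \<le> \<kappa>\<^sub>1 * c + L" using k1_nonneg by simp
  fix x y
  have b: "\<bar>\<phi> k z\<bar> \<le> 1" for k z using \<phi>(1)[of k z] by auto
  have d: "\<bar>\<phi> k (step x k) - \<phi> k (step y k)\<bar> \<le> c * (\<kappa>\<^sub>1 * \<bar>x - y\<bar>)" for k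
  proof -
    have "\<bar>\<phi> k (step x k) - \<phi> k (step y k)\<bar> \<le> c * \<bar>step x k - step y k\<bar>"
      using lipschitz_onD[OF \<phi>(2), of "step x k" "step y k"] by (simp add: dist_real_def)
    also have "\<dots> \<le> c * (\<kappa>\<^sub>1 * \<bar>x - y\<bar>)"
      using step_lip[of x k y k] \<open>0 \<le> c\<close> by (intro mult_left_mono) auto
    finally show ?thesis .
  qed
  let ?P = "\<lambda>x y. \<Sum>k. poisson_weight (max 0 x) k * \<phi> k (step y k)"
  have sm: "summable (\<lambda>k. poisson_weight (max 0 z) k * \<phi> k (step w k))" for z w
    by (intro poisson_expectation_summable[where B = 1] b) auto
  have "?P x x - ?P x y = (\<Sum>k. poisson_weight (max 0 x) k * (\<phi> k (step x k) - \<phi> k (step y k)))"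
    unfolding right_diff_distrib by (rule suminf_diff[OF sm sm])
  also have "\<bar>\<dots>\<bar> \<le> c * (\<kappa>\<^sub>1 * \<bar>x - y\<bar>)"
    by (intro poisson_expectation_abs_le d) auto
  finally have 1: "\<bar>?P x x - ?P x y\<bar> \<le> c * (\<kappa>\<^sub>1 * \<bar>x - y\<bar>)" .
  have "\<bar>?P x y - ?P y y\<bar> \<le> L * \<bar>max 0 x - max 0 y\<bar>"
    by (intro poisson_expectation_lipschitz[where B = 1] b L) auto
  also have "\<dots> \<le> L * \<bar>x - y\<bar>"
    using \<open>0 \<le> L\<close> by (intro mult_left_mono) auto
  finally have 2: "\<bar>?P x y - ?P y y\<bar> \<le> L * \<bar>x - y\<bar>" .
  have "dist (?P x x) (?P y y) \<le> \<bar>?P x x - ?P x y\<bar> + \<bar>?P x y - ?P y y\<bar>"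
    unfolding dist_real_def by linarith
  also have "\<dots> \<le> c * (\<kappa>\<^sub>1 * \<bar>x - y\<bar>) + L * \<bar>x - y\<bar>"
    by (intro add_mono 1 2)
  also have "\<dots> = (\<kappa>\<^sub>1 * c + L) * dist x y"
    by (simp add: dist_real_def algebra_simps)
  finally show "dist (?P x x) (?P y y) \<le> (\<kappa>\<^sub>1 * c + L) * dist x y" .
qed

lemma measurable_node:
  assumes "\<And>k. A k \<in> sets L" "space L = space M" "N t \<in> L \<rightarrow>\<^sub>M count_space UNIV"
  shows "{\<omega> \<in> space M. \<omega> \<in> A (N t \<omega>)} \<in> sets L"
proof -
  have "{\<omega> \<in> space M. \<omega> \<in> A (N t \<omega>)} = (\<Union>k. A k \<inter> (N t -` {k} \<inter> space L))"
    using assms(2) by blast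
  also have "\<dots> \<in> sets L"
    by (rule sets.countable_UN) (auto intro!: sets.Int assms(1) measurable_sets[OF assms(3)])
  finally show ?thesis .
qed

text \<open>For \<open>D\<close> in the past before \<open>t\<close>, the piece of \<open>D\<close>
  with \<open>N t = k\<close> lies in the past before \<open>t + 1\<close>, so
  \<open>\<phi> k\<close> at \<open>lam (t + 1)\<close>, which is \<open>step (lam t) k\<close>
  there, gives its share. Averaging over the Poisson law of \<open>N t\<close> leaves a function of
  \<open>lam t\<close>.\<close>

lemma version_node:
  assumes A: "\<And>k. A k \<in> sets M" and \<phi>: "\<And>k. version (t + 1) UNIV c (A k) (\<phi> k)"
    and L: "\<And>k x. \<bar>\<phi> (Suc k) (step x (Suc k)) - \<phi> k (step x k)\<bar> \<le> L"
  shows "version t UNIV (\<kappa>\<^sub>1 * c + L) {\<omega> \<in> space M. \<omega> \<in> A (N t \<omega>)}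
           (\<lambda>x. \<Sum>k. poisson_weight (max 0 x) k * \<phi> k (step x k))"
proof -
  define P where "P x = (\<Sum>k. poisson_weight (max 0 x) k * \<phi> k (step x k))" for x
  have \<phi>01: "0 \<le> \<phi> k x \<and> \<phi> k x \<le> 1" for k x using versionD(2,3)[OF \<phi>] by auto
  have [measurable]: "\<phi> k \<in> borel_measurable borel" for k using versionD(1)[OF \<phi>] .
  have P01: "0 \<le> P x \<and> P x \<le> 1" for x
    unfolding P_def using poisson_expectation_bounds[of "max 0 x" "\<lambda>k. \<phi> k (step x k)" 1] \<phi>01 by auto
  have P_meas [measurable]: "P \<in> borel_measurable borel"
    unfolding P_def by measurable
  have "measure M ({\<omega> \<in> space M. \<omega> \<in> A (N t \<omega>)} \<inter> D) = (\<integral>\<omega>. indicator D \<omega> * P (lam t \<omega>) \<partial>M)"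
    if D [measurable]: "D \<in> sets (past (t - 1))" for D
  proof -
    have [measurable]: "D \<in> sets M" using D by (rule past_sets)
    define C where "C k = D \<inter> {\<omega> \<in> space M. N t \<omega> = k}" for k
    have C: "C k \<in> sets (past (t + 1 - 1))" for k
    proof -
      have [measurable]: "N t \<in> past t \<rightarrow>\<^sub>M count_space UNIV" by (rule N_past) simp
      have "{\<omega> \<in> space (past t). N t \<omega> = k} \<in> sets (past t)" by measurable
      moreover have "D \<in> sets (past t)" by (rule subsetD[OF sets_past_sigma_mono D]) simp
      ultimately show ?thesis by (auto simp: C_def)
    qed
    have [measurable]: "C k \<in> sets M" for k using C by (rule past_sets)
    have "{\<omega> \<in> space M. \<omega> \<in> A (N t \<omega>)} \<inter> D = (\<Union>k. A k \<inter> C k)"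
      using sets.sets_into_space[OF A] by (auto simp: C_def)
    then have "emeasure M ({\<omega> \<in> space M. \<omega> \<in> A (N t \<omega>)} \<inter> D) = (\<Sum>k. emeasure M (A k \<inter> C k))"
      using A by (subst suminf_emeasure) (auto simp: disjoint_family_on_def C_def)
    also have "\<dots> = (\<Sum>k. \<integral>\<^sup>+\<omega>. indicator (C k) \<omega> * ennreal (\<phi> k (lam (t + 1) \<omega>)) \<partial>M)"
      by (intro suminf_cong version_nn_integral[OF \<phi> C])
    also have "\<dots> = (\<integral>\<^sup>+\<omega>. (\<Sum>k. indicator (C k) \<omega> * ennreal (\<phi> k (lam (t + 1) \<omega>))) \<partial>M)"
      by (rule nn_integral_suminf[symmetric]) measurable
    also have "\<dots> = (\<integral>\<^sup>+\<omega>. indicator D \<omega> * ennreal (\<phi> (N t \<omega>) (step (lam t \<omega>) (N t \<omega>))) \<partial>M)"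
    proof (rule nn_integral_cong)
      fix \<omega> assume \<omega>: "\<omega> \<in> space M"
      have "(\<Sum>k. indicator (C k) \<omega> * ennreal (\<phi> k (lam (t + 1) \<omega>)))
          = (\<Sum>k. (indicator D \<omega> * ennreal (\<phi> k (lam (t + 1) \<omega>))) * indicator {\<omega> \<in> space M. N t \<omega> = k} \<omega>)"
        by (intro suminf_cong) (auto simp: C_def indicator_def)
      also have "\<dots> = indicator D \<omega> * ennreal (\<phi> (N t \<omega>) (lam (t + 1) \<omega>))"
        using \<omega> by (subst suminf_cmult_indicator) (auto simp: disjoint_family_on_def)
      finally show "(\<Sum>k. indicator (C k) \<omega> * ennreal (\<phi> k (lam (t + 1) \<omega>)))
          = indicator D \<omega> * ennreal (\<phi> (N t \<omega>) (step (lam t \<omega>) (N t \<omega>)))"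
        using \<omega> by (simp add: lam_step)
    qed
    also have "\<dots> = (\<integral>\<^sup>+\<omega>. (\<Sum>k. ennreal (poisson_weight (lam t \<omega>) k) * (indicator D \<omega> * ennreal (\<phi> k (step (lam t \<omega>) k)))) \<partial>M)"
      by (rule nn_integral_poisson[where Y = "\<lambda>k \<omega>. indicator D \<omega> * ennreal (\<phi> k (step (lam t \<omega>) k))"]) measurable
    also have "\<dots> = (\<integral>\<^sup>+\<omega>. indicator D \<omega> * ennreal (P (lam t \<omega>)) \<partial>M)"
    proof (rule nn_integral_cong)
      fix \<omega> assume "\<omega> \<in> space M"
      then have l: "0 \<le> lam t \<omega>" by (rule lam_nonneg)
      have "(\<Sum>k. ennreal (poisson_weight (lam t \<omega>) k) * (indicator D \<omega> * ennreal (\<phi> k (step (lam t \<omega>) k))))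
          = indicator D \<omega> * (\<Sum>k. ennreal (poisson_weight (lam t \<omega>) k * \<phi> k (step (lam t \<omega>) k)))"
        using l \<phi>01 by (simp add: ennreal_mult mult.left_commute)
      also have "(\<Sum>k. ennreal (poisson_weight (lam t \<omega>) k * \<phi> k (step (lam t \<omega>) k))) = ennreal (P (lam t \<omega>))"
        unfolding P_def using l \<phi>01
        by (subst suminf_ennreal2) (auto simp: max_def intro!: poisson_expectation_summable[where B = 1])
      finally show "(\<Sum>k. ennreal (poisson_weight (lam t \<omega>) k) * (indicator D \<omega> * ennreal (\<phi> k (step (lam t \<omega>) k))))
          = indicator D \<omega> * ennreal (P (lam t \<omega>))" .
    qed
    finally show ?thesis
      using P01 by (subst version_integral_iff) auto
  qed
  moreover have "(\<kappa>\<^sub>1 * c + L)-lipschitz_on UNIV P"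
    unfolding P_def using \<phi>01 versionD(4)[OF \<phi>] L by (rule poisson_transition_lipschitz[of \<phi> c L])
  ultimately show ?thesis
    unfolding version_def P_def[symmetric] using P01 P_meas by auto
qed

text \<open>The event is read as a node with equal branches: raising the count by one changes the
  probability only through \<open>step\<close>, by at most \<open>\<kappa>\<^sub>2 * c\<close>.
  Together with \<open>\<kappa>\<^sub>1 * c\<close> from the intensity this is the
  contraction.\<close>

lemma version_previous:
  assumes A: "A \<in> sets M" and p: "version (t + 1) UNIV c A p"
  shows "\<exists>q. version t UNIV ((\<kappa>\<^sub>1 + \<kappa>\<^sub>2) * c) A q"
proof -
  have c: "0 \<le> c" using versionD(4)[OF p] by (rule lipschitz_on_nonneg)
  have "\<bar>p (step x (Suc k)) - p (step x k)\<bar> \<le> c * \<kappa>\<^sub>2" for x k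
  proof -
    have "\<bar>p (step x (Suc k)) - p (step x k)\<bar> \<le> c * \<bar>step x (Suc k) - step x k\<bar>"
      using lipschitz_onD[OF versionD(4)[OF p], of "step x (Suc k)" "step x k"] by (simp add: dist_real_def)
    also have "\<dots> \<le> c * \<kappa>\<^sub>2"
      using step_lip[of x "Suc k" x k] c by (intro mult_left_mono) auto
    finally show ?thesis .
  qed
  from version_node[of "\<lambda>_. A" t c "\<lambda>_. p", OF A p this] have "\<exists>q. version t UNIV (\<kappa>\<^sub>1 * c + c * \<kappa>\<^sub>2) {\<omega> \<in> space M. \<omega> \<in> A} q"
    by blast
  moreover have "{\<omega> \<in> space M. \<omega> \<in> A} = A" using sets.sets_into_space[OF A] by auto
  ultimately show ?thesis by (simp add: algebra_simps)
qed

text \<open>Decision trees on the successive counts from time \<open>t\<close> on; the branching is infinite, so their depth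
  may be unbounded.\<close>

inductive cyl :: "int \<Rightarrow> 'a set \<Rightarrow> bool" where
  cyl_empty: "cyl t {}"
| cyl_space: "cyl t (space M)"
| cyl_node: "(\<And>k. cyl (t + 1) (A k)) \<Longrightarrow> cyl t {\<omega> \<in> space M. \<omega> \<in> A (N t \<omega>)}"

lemma cyl_count_sigma: "cyl t A \<Longrightarrow> A \<in> sets (count_sigma M N {t..})"
proof (induction rule: cyl.induct)
  case (cyl_space t)
  have "space (count_sigma M N {t..}) \<in> sets (count_sigma M N {t..})" by (rule sets.top)
  then show ?case by simp
next
  case (cyl_node t A)
  have "A k \<in> sets (count_sigma M N {t..})" for k
    using cyl_node.IH[of k] sets_count_sigma_mono[of "{t + 1..}" "{t..}"] by auto
  then show ?case
    by (intro measurable_node measurable_count_sigma) auto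
qed simp

lemma count_sigma_sets: "A \<in> sets (count_sigma M N I) \<Longrightarrow> A \<in> sets M"
  by (rule subsetD[OF sets_count_sigma_subset[OF sets.sigma_algebra_axioms]]) auto

lemma cyl_sets: "cyl t A \<Longrightarrow> A \<in> sets M"
  by (rule count_sigma_sets[OF cyl_count_sigma])

lemma cyl_compl: "cyl t A \<Longrightarrow> cyl t (space M - A)"
proof (induction rule: cyl.induct)
  case (cyl_node t A)
  then have "cyl t {\<omega> \<in> space M. \<omega> \<in> (\<lambda>k. space M - A k) (N t \<omega>)}"
    by (intro cyl.cyl_node)
  moreover have "{\<omega> \<in> space M. \<omega> \<in> (\<lambda>k. space M - A k) (N t \<omega>)} = space M - {\<omega> \<in> space M. \<omega> \<in> A (N t \<omega>)}" by auto
  ultimately show ?case by simp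
qed (auto intro: cyl.intros)

text \<open>Two trees with the same starting time branch on the same count, so they can be
  intersected branch by branch.\<close>

lemma cyl_Int: "cyl t A \<Longrightarrow> cyl t B \<Longrightarrow> cyl t (A \<inter> B)"
proof (induction arbitrary: B rule: cyl.induct)
  case (cyl_space t)
  then show ?case using sets.sets_into_space[OF cyl_sets] by (simp add: Int_absorb1)
next
  case (cyl_node t A)
  note nodeA = cyl_node.hyps and IH = cyl_node.IH
  from \<open>cyl t B\<close> show ?case
  proof cases
    case (cyl_node A')
    have "cyl t {\<omega> \<in> space M. \<omega> \<in> (\<lambda>k. A k \<inter> A' k) (N t \<omega>)}"
      using cyl_node by (intro cyl.cyl_node IH)
    moreover have "{\<omega> \<in> space M. \<omega> \<in> (\<lambda>k. A k \<inter> A' k) (N t \<omega>)} = {\<omega> \<in> space M. \<omega> \<in> A (N t \<omega>)} \<inter> B"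
      using cyl_node by auto
    ultimately show ?thesis by simp
  next
    case cyl_space
    have "cyl t {\<omega> \<in> space M. \<omega> \<in> A (N t \<omega>)}" by (intro cyl.cyl_node nodeA)
    then show ?thesis using cyl_space sets.sets_into_space[OF cyl_sets] by (simp add: Int_absorb2)
  qed (auto intro: cyl.cyl_empty)
qed (auto intro: cyl.intros)

lemma algebra_cyl: "algebra (space M) {A. cyl t A}"
  unfolding algebra_iff_Int
  using sets.sets_into_space[OF cyl_sets] by (auto intro: cyl_compl cyl_Int cyl_empty)

text \<open>A tree branches at every time from \<open>t\<close> on without skipping, so the count at
  \<open>s\<close> is reached by putting \<open>s - t\<close> nodes with equal branches in
  front.\<close>

lemma cyl_generator:
  assumes "t \<le> s" shows "cyl t (N s -` B \<inter> space M)"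
proof -
  have "cyl (s - int n) (N s -` B \<inter> space M)" for n
  proof (induction n)
    case 0
    have "cyl s {\<omega> \<in> space M. \<omega> \<in> (if N s \<omega> \<in> B then space M else {})}"
      by (rule cyl_node) (auto intro: cyl.intros)
    moreover have "{\<omega> \<in> space M. \<omega> \<in> (if N s \<omega> \<in> B then space M else {})} = N s -` B \<inter> space M" by auto
    ultimately show ?case by simp
  next
    case (Suc n)
    have "cyl (s - int (Suc n)) {\<omega> \<in> space M. \<omega> \<in> N s -` B \<inter> space M}"
      using Suc by (intro cyl_node) (simp add: algebra_simps)
    moreover have "{\<omega> \<in> space M. \<omega> \<in> N s -` B \<inter> space M} = N s -` B \<inter> space M" by auto
    ultimately show ?case by simp
  qed
  from this[of "nat (s - t)"] assms show ?thesis by simp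
qed

lemma count_sigma_cyl: "sets (count_sigma M N {t..}) \<subseteq> sigma_sets (space M) {A. cyl t A}"
  unfolding sets_count_sigma by (rule sigma_sets_mono') (auto intro: cyl_generator)

lemma approximate_by_cyl:
  assumes "A \<in> sets (count_sigma M N {t..})" "0 < e"
  obtains B where "cyl t B" "measure M (sym_diff A B) < e"
proof -
  have "\<exists>B\<in>{A. cyl t A}. measure M (sym_diff A B) < e"
    using assms count_sigma_cyl[of t] cyl_sets[of t]
    by (intro approximate_by_algebra algebra_cyl) auto
  then show ?thesis using that by auto
qed

text \<open>\<open>1 / (1 - \<kappa>\<^sub>1)\<close> is the fixed point of
  \<open>c \<mapsto> \<kappa>\<^sub>1 * c + 1\<close>, where 1 bounds the difference of any two
  probabilities. A fixed point is what lets one constant serve trees of every depth.\<close>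

lemma cyl_version: "cyl t A \<Longrightarrow> \<exists>p. version t UNIV (1 / (1 - \<kappa>\<^sub>1)) A p"
proof (induction rule: cyl.induct)
  case (cyl_empty t)
  have "version t UNIV 0 {} (\<lambda>_. 0)"
    by (auto simp: version_def intro: lipschitz_on_constant)
  then have "version t UNIV (1 / (1 - \<kappa>\<^sub>1)) {} (\<lambda>_. 0)"
    by (rule version_mono) (use k1_less_1 in auto)
  then show ?case by blast
next
  case (cyl_space t)
  have "version t UNIV 0 (space M) (\<lambda>_. 1)"
    using past_sets by (auto simp: version_def intro: lipschitz_on_constant)
  then have "version t UNIV (1 / (1 - \<kappa>\<^sub>1)) (space M) (\<lambda>_. 1)"
    by (rule version_mono) (use k1_less_1 in auto)
  then show ?case by blast
next
  case (cyl_node t A)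
  then obtain \<phi> where \<phi>: "\<And>k. version (t + 1) UNIV (1 / (1 - \<kappa>\<^sub>1)) (A k) (\<phi> k)" by metis
  have "\<bar>\<phi> (Suc k) (step x (Suc k)) - \<phi> k (step x k)\<bar> \<le> 1" for k x
    using versionD(2,3)[OF \<phi>[of "Suc k"], of "step x (Suc k)"] versionD(2,3)[OF \<phi>[of k], of "step x k"] by auto
  from version_node[of A t _ \<phi>, OF cyl_sets[OF cyl_node.hyps] \<phi> this]
  have "\<exists>p. version t UNIV (\<kappa>\<^sub>1 * (1 / (1 - \<kappa>\<^sub>1)) + 1) {\<omega> \<in> space M. \<omega> \<in> A (N t \<omega>)} p" by blast
  moreover have "\<kappa>\<^sub>1 * (1 / (1 - \<kappa>\<^sub>1)) + 1 = 1 / (1 - \<kappa>\<^sub>1)" using k1_less_1 by (simp add: field_simps)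
  ultimately show ?case by simp
qed

definition rate :: "nat \<Rightarrow> real" where "rate n = (\<kappa>\<^sub>1 + \<kappa>\<^sub>2) ^ n / (1 - \<kappa>\<^sub>1)"

lemma rate_nonneg: "0 \<le> rate n"
  using k1_nonneg k2_nonneg k1_less_1 by (simp add: rate_def)

lemma cyl_version_past: "cyl (t + int n) A \<Longrightarrow> \<exists>p. version t UNIV (rate n) A p"
proof (induction n arbitrary: t)
  case 0 then show ?case using cyl_version by (simp add: rate_def)
next
  case (Suc n)
  have "cyl (t + 1 + int n) A" using Suc.prems by (simp add: algebra_simps)
  then obtain p where "version (t + 1) UNIV (rate n) A p" using Suc.IH by blast
  from version_previous[OF cyl_sets[OF Suc.prems] this] show ?case by (simp add: rate_def)
qed

end

section \<open>Uniqueness of Lipschitz versions on the support of the intensity\<close>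

lemma measure_sym_diff_bound:
  assumes "finite_measure M" "A \<in> sets M" "B \<in> sets M" "D \<in> sets M"
  shows "\<bar>measure M (A \<inter> D) - measure M (B \<inter> D)\<bar> \<le> measure M (sym_diff A B)"
proof -
  interpret finite_measure M by fact
  have "measure M (A \<inter> D) \<le> measure M ((B \<inter> D) \<union> sym_diff A B)"
    using assms by (intro finite_measure_mono) auto
  also have "\<dots> \<le> measure M (B \<inter> D) + measure M (sym_diff A B)"
    using assms by (intro measure_Un_le) auto
  finally have 1: "measure M (A \<inter> D) \<le> measure M (B \<inter> D) + measure M (sym_diff A B)" .
  have "measure M (B \<inter> D) \<le> measure M ((A \<inter> D) \<union> sym_diff A B)"
    using assms by (intro finite_measure_mono) auto
  also have "\<dots> \<le> measure M (A \<inter> D) + measure M (sym_diff A B)"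
    using assms by (intro measure_Un_le) auto
  finally show ?thesis using 1 by linarith
qed

context contractive_poisson_process
begin

text \<open>The topological support of the law of \<open>lam t\<close>. Around its points every
  neighbourhood has positive mass, so almost sure information about a Lipschitz function determines
  its value at each of them.\<close>

definition supp :: "int \<Rightarrow> real set" where
  "supp t = {x. \<forall>U. open U \<longrightarrow> x \<in> U \<longrightarrow> measure M (lam t -` U \<inter> space M) > 0}"

lemma closed_supp: "closed (supp t)"
proof -
  have "- supp t = \<Union>{U. open U \<and> measure M (lam t -` U \<inter> space M) = 0}"
    by (auto simp: supp_def zero_less_measure_iff)
  then have "open (- supp t)" by auto
  then show ?thesis by (simp add: closed_def)
qed

lemma borel_supp [measurable]: "supp t \<in> sets borel"
  using closed_supp by (rule borel_closed)

text \<open>The complement is a union of open sets of probability 0, and the Lindelof property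
  reduces it to a countable union.\<close>

lemma AE_lam_supp: "AE \<omega> in M. lam t \<omega> \<in> supp t"
proof -
  let ?F = "{U. open U \<and> measure M (lam t -` U \<inter> space M) = 0}"
  obtain F' where F': "F' \<subseteq> ?F" "countable F'" "\<Union>F' = \<Union>?F"
    using Lindelof[of ?F] by (metis (no_types, lifting) mem_Collect_eq)
  have "AE \<omega> in M. \<forall>U\<in>F'. lam t \<omega> \<notin> U"
  proof (subst AE_ball_countable[OF F'(2)], intro ballI)
    fix U assume "U \<in> F'"
    then have U: "open U" "measure M (lam t -` U \<inter> space M) = 0" using F'(1) by auto
    have "lam t -` U \<inter> space M \<in> sets M" by (rule measurable_sets[OF lam_meas borel_open[OF U(1)]])
    then have "lam t -` U \<inter> space M \<in> null_sets M" using U(2) by (simp add: emeasure_eq_measure null_setsI)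
    then show "AE \<omega> in M. lam t \<omega> \<notin> U" by (rule AE_I') auto
  qed
  moreover have "x \<in> supp t" if "\<forall>U\<in>F'. x \<notin> U" for x
  proof -
    have "x \<notin> \<Union>?F" using that F'(3) by blast
    then show ?thesis by (auto simp: supp_def zero_less_measure_iff)
  qed
  ultimately show ?thesis by (auto elim!: eventually_mono)
qed

definition near :: "int \<Rightarrow> real \<Rightarrow> real \<Rightarrow> 'a set" where
  "near t x e = lam t -` ball x e \<inter> space M"

lemma near_past: "near t x e \<in> sets (past (t - 1))"
  using measurable_sets[OF lam_past_pred, of "ball x e" t] by (simp add: near_def)

lemma near_pos: "x \<in> supp t \<Longrightarrow> 0 < e \<Longrightarrow> 0 < measure M (near t x e)"
  by (simp add: supp_def near_def)

text \<open>On the support of the law of \<open>lam t\<close>, a Lipschitz function is controlled by its averages over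
  neighbourhoods; this makes Lipschitz versions of conditional probabilities unique there.\<close>

lemma average_bound:
  assumes [measurable]: "g \<in> borel_measurable borel" and B: "\<And>y. \<bar>g y\<bar> \<le> B"
    and K: "K-lipschitz_on (supp t) g" and x: "x \<in> supp t" and "0 < e"
    and \<eta>: "\<bar>\<integral>\<omega>. indicator (near t x e) \<omega> * g (lam t \<omega>) \<partial>M\<bar> \<le> \<eta>"
  shows "\<bar>g x\<bar> * measure M (near t x e) \<le> \<eta> + K * e * measure M (near t x e)"
proof -
  let ?D = "near t x e"
  have D [measurable]: "?D \<in> sets M" using near_past by (rule past_sets)
  have int: "integrable M (\<lambda>\<omega>. indicator ?D \<omega> * g (lam t \<omega>))"
  proof (rule integrable_const_bound[of _ B])
    have "0 \<le> B" using B[of 0] by linarith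
    then show "AE \<omega> in M. norm (indicator ?D \<omega> * g (lam t \<omega>)) \<le> B"
      using B by (auto simp: indicator_def)
  qed measurable
  have intc: "integrable M (\<lambda>\<omega>. indicator ?D \<omega> * c)" for c :: real
    by (intro integrable_mult_left integrable_real_indicator D) (simp add: emeasure_eq_measure)
  \<comment> \<open>The Lipschitz bound relates points of the support only, and \<open>lam t\<close>
    lies there almost surely; hence the estimate under \<open>AE\<close>.\<close>
  have close: "AE \<omega> in M. \<omega> \<in> ?D \<longrightarrow> \<bar>g (lam t \<omega>) - g x\<bar> \<le> K * e"
    using AE_lam_supp[of t]
  proof (rule AE_mp, intro AE_I2 impI)
    fix \<omega> assume "lam t \<omega> \<in> supp t" "\<omega> \<in> ?D"
    then have "dist (g (lam t \<omega>)) (g x) \<le> K * dist (lam t \<omega>) x"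
      using x by (intro lipschitz_onD[OF K]) auto
    also have "\<dots> \<le> K * e"
      using \<open>\<omega> \<in> ?D\<close> lipschitz_on_nonneg[OF K] by (intro mult_left_mono) (auto simp: near_def dist_commute)
    finally show "\<bar>g (lam t \<omega>) - g x\<bar> \<le> K * e" by (simp add: dist_real_def)
  qed
  have "(\<integral>\<omega>. indicator ?D \<omega> * (g x - K * e) \<partial>M) \<le> (\<integral>\<omega>. indicator ?D \<omega> * g (lam t \<omega>) \<partial>M)"
    by (intro integral_mono_AE int intc) (use close in \<open>auto simp: indicator_def elim!: eventually_mono\<close>)
  moreover have "(\<integral>\<omega>. indicator ?D \<omega> * g (lam t \<omega>) \<partial>M) \<le> (\<integral>\<omega>. indicator ?D \<omega> * (g x + K * e) \<partial>M)"
    by (intro integral_mono_AE int intc) (use close in \<open>auto simp: indicator_def elim!: eventually_mono\<close>)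
  ultimately have "measure M ?D * (g x - K * e) \<le> \<eta>" "- \<eta> \<le> measure M ?D * (g x + K * e)"
    using \<eta> by auto
  then show ?thesis
    by (cases "0 \<le> g x") (auto simp: algebra_simps)
qed

text \<open>The integral of \<open>p - q\<close> over the neighbourhood is the difference of the
  probabilities of \<open>A\<close> and \<open>B\<close> within it, which the symmetric difference
  bounds; the term with \<open>e\<close> is the oscillation of \<open>p - q\<close>.\<close>

lemma version_close:
  assumes A: "A \<in> sets M" "version t (supp t) c A p" and B: "B \<in> sets M" "version t (supp t) c B q"
    and x: "x \<in> supp t" and e: "0 < e"
  shows "\<bar>p x - q x\<bar> * measure M (near t x e) \<le> measure M (sym_diff A B) + (c + c) * e * measure M (near t x e)"
proof (rule average_bound[where g = "\<lambda>y. p y - q y" and B = 1])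
  note [measurable] = versionD(1)[OF A(2)] versionD(1)[OF B(2)]
  have D [measurable]: "near t x e \<in> sets M" using near_past by (rule past_sets)
  show "(\<lambda>y. p y - q y) \<in> borel_measurable borel" by measurable
  show "\<bar>p y - q y\<bar> \<le> 1" for y
    using versionD(2,3)[OF A(2), of y] versionD(2,3)[OF B(2), of y] by auto
  show "(c + c)-lipschitz_on (supp t) (\<lambda>y. p y - q y)"
    by (intro lipschitz_on_diff versionD(4)[OF A(2)] versionD(4)[OF B(2)])
  have "(\<integral>\<omega>. indicator (near t x e) \<omega> * (p (lam t \<omega>) - q (lam t \<omega>)) \<partial>M)
      = measure M (A \<inter> near t x e) - measure M (B \<inter> near t x e)"
    unfolding versionD(5)[OF A(2) near_past, of x e] versionD(5)[OF B(2) near_past, of x e] right_diff_distrib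
    by (intro Bochner_Integration.integral_diff integrable_indicator_bounded D conjI versionD(1-3)[OF A(2)] versionD(1-3)[OF B(2)])
  then show "\<bar>\<integral>\<omega>. indicator (near t x e) \<omega> * (p (lam t \<omega>) - q (lam t \<omega>)) \<partial>M\<bar> \<le> measure M (sym_diff A B)"
    using measure_sym_diff_bound[OF finite_measure_axioms A(1) B(1) D] by simp
qed (use x e in auto)

text \<open>Evaluation at a fixed \<open>x\<close> is continuous in the event with respect to the
  measure of the symmetric difference. The modulus is the same for all events; it depends on
  \<open>x\<close> through the mass of its neighbourhoods.\<close>

lemma version_modulus:
  assumes x: "x \<in> supp t" and "0 \<le> c" "0 < e"
  obtains d where "0 < d"
    "\<And>A B p q. A \<in> sets M \<Longrightarrow> B \<in> sets M \<Longrightarrow> version t (supp t) c A p \<Longrightarrow> version t (supp t) c B q \<Longrightarrow>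
       measure M (sym_diff A B) < d \<Longrightarrow> \<bar>p x - q x\<bar> < e"
proof -
  \<comment> \<open>With this radius the oscillation \<open>(c + c) * r\<close> takes at most half
    of \<open>e\<close>; the summand 1 keeps the denominator positive when \<open>c\<close> is
    0.\<close>
  define r where "r = e / (2 * (c + c + 1))"
  define m where "m = measure M (near t x r)"
  have r: "0 < r" using assms by (simp add: r_def)
  have m: "0 < m" unfolding m_def by (rule near_pos[OF x r])
  have "(c + c) * r \<le> (c + c + 1) * r" using r by (simp add: algebra_simps)
  also have "\<dots> = e / 2" using assms by (simp add: r_def field_simps)
  finally have cr: "(c + c) * r \<le> e / 2" .
  show ?thesis
  proof (rule that[of "m * (e / 2)"])
    show "0 < m * (e / 2)" using m assms by simp
    fix A B p q assume *: "A \<in> sets M" "B \<in> sets M" "version t (supp t) c A p" "version t (supp t) c B q"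
      "measure M (sym_diff A B) < m * (e / 2)"
    have "\<bar>p x - q x\<bar> * m \<le> measure M (sym_diff A B) + (c + c) * r * m"
      unfolding m_def by (rule version_close) (use * x r in auto)
    also have "\<dots> < m * (e / 2) + (e / 2) * m"
      using * cr m by (intro add_less_le_mono mult_right_mono) auto
    also have "\<dots> = e * m" by simp
    finally show "\<bar>p x - q x\<bar> < e" using m by simp
  qed
qed

lemma version_unique:
  assumes "A \<in> sets M" "version t (supp t) c A p" "version t (supp t) c A q" and x: "x \<in> supp t"
  shows "p x = q x"
proof (rule ccontr)
  assume "p x \<noteq> q x"
  then have "0 < \<bar>p x - q x\<bar>" by simp
  with lipschitz_on_nonneg[OF versionD(4)[OF assms(2)]] show False
    by (rule version_modulus[OF x]) (use assms in fastforce)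
qed

lemma version_tendsto:
  assumes A: "A \<in> sets M" "version t (supp t) c A p"
    and B: "\<And>m. B m \<in> sets M" "\<And>m. version t (supp t) c (B m) (q m)"
    and lim: "(\<lambda>m. measure M (sym_diff A (B m))) \<longlonglongrightarrow> 0" and x: "x \<in> supp t"
  shows "(\<lambda>m. q m x) \<longlonglongrightarrow> p x"
proof (rule tendstoI)
  fix e :: real assume "0 < e"
  obtain d where d: "0 < d"
    "\<And>A B p q. A \<in> sets M \<Longrightarrow> B \<in> sets M \<Longrightarrow> version t (supp t) c A p \<Longrightarrow> version t (supp t) c B q \<Longrightarrow>
       measure M (sym_diff A B) < d \<Longrightarrow> \<bar>p x - q x\<bar> < e"
    using version_modulus[OF x lipschitz_on_nonneg[OF versionD(4)[OF A(2)]] \<open>0 < e\<close>] by metis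
  have "eventually (\<lambda>m. measure M (sym_diff A (B m)) < d) sequentially"
    using lim d(1) by (rule order_tendstoD)
  then show "eventually (\<lambda>m. dist (q m x) (p x) < e) sequentially"
    by eventually_elim (use d(2)[OF A(1) B(1) A(2) B(2)] in \<open>simp add: dist_real_def abs_minus_commute\<close>)
qed

text \<open>The versions of approximating tree events share one Lipschitz constant, so the modulus
  makes them Cauchy at every point of the support. The limit inherits the constant, and dominated
  convergence preserves the integral identity because \<open>lam t\<close> almost surely lies in the
  support.\<close>

lemma version_exists:
  assumes A: "A \<in> sets (count_sigma M N {t + int n..})"
  shows "\<exists>p. version t (supp t) (rate n) A p"
proof -
  have AM [measurable]: "A \<in> sets M" using A by (rule count_sigma_sets)
  have "\<exists>B. cyl (t + int n) B \<and> measure M (sym_diff A B) < inverse (real (Suc m))" for m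
    using approximate_by_cyl[OF A, of "inverse (real (Suc m))"] by (metis inverse_positive_iff_positive of_nat_0_less_iff zero_less_Suc)
  then obtain B where B: "\<And>m. cyl (t + int n) (B m)" "\<And>m. measure M (sym_diff A (B m)) < inverse (real (Suc m))"
    by metis
  have BM [measurable]: "B m \<in> sets M" for m using B(1) by (rule cyl_sets)
  obtain q where q: "\<And>m. version t UNIV (rate n) (B m) (q m)"
    using cyl_version_past[OF B(1)] by metis
  then have qs: "version t (supp t) (rate n) (B m) (q m)" for m
    by (rule version_mono) auto
  note [measurable] = versionD(1)[OF q]
  have lim0: "(\<lambda>m. measure M (sym_diff A (B m))) \<longlonglongrightarrow> 0"
    by (rule tendsto_sandwich[OF _ _ tendsto_const LIMSEQ_inverse_real_of_nat]) (use B(2) in \<open>auto intro!: always_eventually less_imp_le simp del: of_nat_Suc\<close>)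
  define p where "p x = (if x \<in> supp t then lim (\<lambda>m. q m x) else 0)" for x
  have lim: "(\<lambda>m. q m x) \<longlonglongrightarrow> p x" if x: "x \<in> supp t" for x
  proof -
    have "Cauchy (\<lambda>m. q m x)"
    proof (rule metric_CauchyI)
      fix e :: real assume "0 < e"
      obtain d where d: "0 < d"
        "\<And>A B p q. A \<in> sets M \<Longrightarrow> B \<in> sets M \<Longrightarrow> version t (supp t) (rate n) A p \<Longrightarrow> version t (supp t) (rate n) B q \<Longrightarrow>
           measure M (sym_diff A B) < d \<Longrightarrow> \<bar>p x - q x\<bar> < e"
        using version_modulus[OF x rate_nonneg \<open>0 < e\<close>] by metis
      have "eventually (\<lambda>m. measure M (sym_diff A (B m)) < d / 2) sequentially"
        using lim0 d(1) by (intro order_tendstoD) auto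
      then obtain m0 where m0: "\<And>m. m0 \<le> m \<Longrightarrow> measure M (sym_diff A (B m)) < d / 2"
        by (auto simp: eventually_sequentially)
      show "\<exists>m0. \<forall>m\<ge>m0. \<forall>k\<ge>m0. dist (q m x) (q k x) < e"
      proof (intro exI[of _ m0] allI impI)
        fix m k assume mk: "m0 \<le> m" "m0 \<le> k"
        have "measure M (sym_diff (B m) (B k)) \<le> measure M (sym_diff A (B m) \<union> sym_diff A (B k))"
          by (intro finite_measure_mono) auto
        also have "\<dots> \<le> measure M (sym_diff A (B m)) + measure M (sym_diff A (B k))"
          by (intro measure_Un_le) auto
        also have "\<dots> < d" using m0[OF mk(1)] m0[OF mk(2)] by simp
        finally show "dist (q m x) (q k x) < e"
          unfolding dist_real_def by (rule d(2)[OF BM BM qs qs])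
      qed
    qed
    then show ?thesis using x by (simp add: p_def Cauchy_convergent_iff convergent_LIMSEQ_iff)
  qed
  have [measurable]: "p \<in> borel_measurable borel"
    unfolding p_def by measurable
  have p01: "0 \<le> p x \<and> p x \<le> 1" for x
  proof (cases "x \<in> supp t")
    case True
    show ?thesis
      using LIMSEQ_le_const[OF lim[OF True], of 0] LIMSEQ_le_const2[OF lim[OF True], of 1] versionD(2,3)[OF q] by blast
  qed (simp add: p_def)
  have "(rate n)-lipschitz_on (supp t) p"
  proof (rule lipschitz_onI[OF _ rate_nonneg])
    fix x y assume xy: "x \<in> supp t" "y \<in> supp t"
    show "dist (p x) (p y) \<le> rate n * dist x y"
      by (rule LIMSEQ_le_const2[OF tendsto_dist[OF lim[OF xy(1)] lim[OF xy(2)]]])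
        (use lipschitz_onD[OF versionD(4)[OF q]] in auto)
  qed
  moreover have "measure M (A \<inter> D) = (\<integral>\<omega>. indicator D \<omega> * p (lam t \<omega>) \<partial>M)" if D: "D \<in> sets (past (t - 1))" for D
  proof (rule LIMSEQ_unique)
    have [measurable]: "D \<in> sets M" using D by (rule past_sets)
    have "(\<lambda>m. measure M (B m \<inter> D) - measure M (A \<inter> D)) \<longlonglongrightarrow> 0"
      by (rule Lim_null_comparison[OF _ lim0])
        (use measure_sym_diff_bound[OF finite_measure_axioms AM BM] in \<open>auto simp: abs_minus_commute\<close>)
    then show "(\<lambda>m. measure M (B m \<inter> D)) \<longlonglongrightarrow> measure M (A \<inter> D)" by (rule LIM_zero_cancel)
    have "(\<lambda>m. \<integral>\<omega>. indicator D \<omega> * q m (lam t \<omega>) \<partial>M) \<longlonglongrightarrow> (\<integral>\<omega>. indicator D \<omega> * p (lam t \<omega>) \<partial>M)"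
    proof (rule integral_dominated_convergence[where w = "\<lambda>_. 1"])
      show "AE \<omega> in M. (\<lambda>m. indicator D \<omega> * q m (lam t \<omega>)) \<longlonglongrightarrow> indicator D \<omega> * p (lam t \<omega>)"
        using AE_lam_supp[of t] by eventually_elim (intro tendsto_intros lim)
      show "AE \<omega> in M. norm (indicator D \<omega> * q m (lam t \<omega>)) \<le> 1" for m
        using versionD(2,3)[OF q] by (auto simp: indicator_def)
    qed auto
    then show "(\<lambda>m. measure M (B m \<inter> D)) \<longlonglongrightarrow> (\<integral>\<omega>. indicator D \<omega> * p (lam t \<omega>) \<partial>M)"
      unfolding versionD(5)[OF q D] .
  qed
  ultimately have "version t (supp t) (rate n) A p"
    using p01 unfolding version_def by auto
  then show ?thesis by blast
qed

text \<open>On the support the choice is determined by \<open>version_unique\<close>; elsewhere only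
  measurability and the bounds 0 and 1 are guaranteed.\<close>

definition count_prob :: "int \<Rightarrow> nat \<Rightarrow> 'a set \<Rightarrow> real \<Rightarrow> real" where
  "count_prob t n A = (SOME p. version t (supp t) (rate n) A p)"

abbreviation future :: "int \<Rightarrow> nat \<Rightarrow> 'a measure" where
  "future t n \<equiv> count_sigma M N {t + int n..}"

lemma version_count_prob:
  "A \<in> sets (future t n) \<Longrightarrow> version t (supp t) (rate n) A (count_prob t n A)"
  unfolding count_prob_def by (rule someI_ex[OF version_exists])

lemma count_prob_const:
  assumes "c = 0 \<and> A = {} \<or> c = 1 \<and> A = space M" and x: "x \<in> supp t"
  shows "count_prob t n A x = c"
proof (rule version_unique[OF _ version_count_prob _ x])
  show "A \<in> sets (future t n)" "A \<in> sets M"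
    using assms(1) sets.top[of "future t n"] by auto
  have "version t (supp t) 0 A (\<lambda>_. c)"
    using assms(1) past_sets[of _ "t - 1"] by (auto simp: version_def intro: lipschitz_on_constant)
  then show "version t (supp t) (rate n) A (\<lambda>_. c)"
    using rate_nonneg by (rule version_mono[OF _ subset_refl])
qed

text \<open>Off the support the sum of two versions may exceed 1 and then fails to be a
  \<open>version\<close>, so uniqueness is derived directly from \<open>average_bound\<close>: the
  difference has integral 0 over every neighbourhood, and the radius tends to 0.\<close>

lemma count_prob_additive:
  assumes A: "A \<in> sets (future t n)" and B: "B \<in> sets (future t n)" and AB: "A \<inter> B = {}" and x: "x \<in> supp t"
  shows "count_prob t n (A \<union> B) x = count_prob t n A x + count_prob t n B x"
proof -
  let ?p = "count_prob t n A" and ?q = "count_prob t n B" and ?r = "count_prob t n (A \<union> B)"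
  have U: "A \<union> B \<in> sets (future t n)" using A B by auto
  note p = versionD[OF version_count_prob[OF A]] and q = versionD[OF version_count_prob[OF B]]
    and r = versionD[OF version_count_prob[OF U]]
  note [measurable] = p(1) q(1) r(1)
  let ?g = "\<lambda>y. ?r y - (?p y + ?q y)"
  define C where "C = rate n + (rate n + rate n)"
  have C: "0 \<le> C" using rate_nonneg[of n] by (simp add: C_def)
  have *: "\<bar>?g x\<bar> \<le> C * e" if e: "0 < e" for e
  proof -
    have D [measurable]: "near t x e \<in> sets M" using near_past by (rule past_sets)
    have "\<bar>?g x\<bar> * measure M (near t x e) \<le> 0 + C * e * measure M (near t x e)"
    proof (rule average_bound[where B = 2])
      show "\<bar>?g y\<bar> \<le> 2" for y using p(2,3)[of y] q(2,3)[of y] r(2,3)[of y] by auto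
      show "C-lipschitz_on (supp t) ?g"
        unfolding C_def by (intro lipschitz_on_diff lipschitz_on_add p(4) q(4) r(4))
      have i: "integrable M (\<lambda>\<omega>. indicator (near t x e) \<omega> * ?r (lam t \<omega>))"
        "integrable M (\<lambda>\<omega>. indicator (near t x e) \<omega> * ?p (lam t \<omega>))"
        "integrable M (\<lambda>\<omega>. indicator (near t x e) \<omega> * ?q (lam t \<omega>))"
        by (auto intro!: integrable_indicator_bounded p(2,3) q(2,3) r(2,3))
      have "(\<integral>\<omega>. indicator (near t x e) \<omega> * ?g (lam t \<omega>) \<partial>M)
          = measure M ((A \<union> B) \<inter> near t x e) - (measure M (A \<inter> near t x e) + measure M (B \<inter> near t x e))"
        using i p(5)[OF near_past, of x e] q(5)[OF near_past, of x e] r(5)[OF near_past, of x e]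
        by (simp add: right_diff_distrib distrib_left)
      also have "(A \<union> B) \<inter> near t x e = (A \<inter> near t x e) \<union> (B \<inter> near t x e)" by auto
      also have "measure M \<dots> = measure M (A \<inter> near t x e) + measure M (B \<inter> near t x e)"
        using AB A B count_sigma_sets by (intro finite_measure_Union) auto
      finally show "\<bar>\<integral>\<omega>. indicator (near t x e) \<omega> * ?g (lam t \<omega>) \<partial>M\<bar> \<le> 0" by simp
    qed (use x e in auto)
    then show ?thesis using near_pos[OF x e] by simp
  qed
  have "\<bar>?g x\<bar> \<le> 0"
  proof (rule field_le_epsilon)
    fix e :: real assume "0 < e"
    then have "\<bar>?g x\<bar> \<le> C * (e / (C + 1))" using C by (intro *) simp
    also have "\<dots> \<le> e" using C \<open>0 < e\<close> by (simp add: field_simps)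
    finally show "\<bar>?g x\<bar> \<le> 0 + e" by simp
  qed
  then show ?thesis by simp
qed

text \<open>Continuity along increasing events holds since convergence in measure becomes
  convergence at the point \<open>x\<close> itself. The same \<open>x\<close> serves all sequences
  of events, so no null set has to be discarded.\<close>

lemma count_prob_countably_additive:
  assumes x: "x \<in> supp t"
  shows "countably_additive (sets (future t n)) (\<lambda>A. ennreal (count_prob t n A x))"
proof -
  let ?\<mu> = "\<lambda>A. ennreal (count_prob t n A x)"
  have "positive (sets (future t n)) ?\<mu>"
    using count_prob_const[of 0 "{}", OF _ x] by (simp add: positive_def)
  moreover have "additive (sets (future t n)) ?\<mu>"
    unfolding additive_def
    using x versionD(2)[OF version_count_prob] by (auto simp: count_prob_additive simp flip: ennreal_plus)
  moreover have "(\<lambda>i. ?\<mu> (A i)) \<longlonglongrightarrow> ?\<mu> (\<Union>i. A i)"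
    if A: "range A \<subseteq> sets (future t n)" "incseq A" for A
  proof (intro tendsto_ennrealI version_tendsto[OF _ version_count_prob _ version_count_prob _ x])
    have AM [measurable]: "A i \<in> sets M" for i using A(1) by (intro count_sigma_sets) auto
    show "A i \<in> sets M" "A i \<in> sets (future t n)" for i using AM A(1) by auto
    show "(\<Union>i. A i) \<in> sets M" "(\<Union>i. A i) \<in> sets (future t n)" using AM A(1) by auto
    have "(\<lambda>i. measure M (\<Union>i. A i) - measure M (A i)) \<longlonglongrightarrow> measure M (\<Union>i. A i) - measure M (\<Union>i. A i)"
      using A by (intro tendsto_diff tendsto_const finite_Lim_measure_incseq) auto
    moreover have "measure M (\<Union>i. A i) - measure M (A m) = measure M (sym_diff (\<Union>i. A i) (A m))" for m
    proof -
      have "sym_diff (\<Union>i. A i) (A m) = (\<Union>i. A i) - A m" by auto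
      then show ?thesis by (simp add: finite_measure_Diff UN_upper)
    qed
    ultimately show "(\<lambda>m. measure M (sym_diff (\<Union>i. A i) (A m))) \<longlonglongrightarrow> 0" by simp
  qed
  ultimately show ?thesis
    by (subst sets.countably_additive_iff_continuous_from_below) auto
qed

section \<open>Regular conditional probability and mixing coefficients\<close>

text \<open>Off the support the unconditional law is the default, because a kernel into
  \<open>prob_algebra\<close> must be a probability measure at every argument.\<close>

definition count_kernel :: "int \<Rightarrow> nat \<Rightarrow> real \<Rightarrow> 'a measure" where
  "count_kernel t n x = (if x \<in> supp t then measure_of (space M) (sets (future t n)) (\<lambda>A. ennreal (count_prob t n A x))
     else restr_to_subalg M (future t n))"

lemma subalgebra_count_sigma: "subalgebra M (count_sigma M N I)"
  using count_sigma_sets by (auto simp: subalgebra_def)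

lemma sets_kernel [simp]: "sets (count_kernel t n x) = sets (future t n)"
proof -
  have "sets (measure_of (space M) (sets (future t n)) (\<lambda>A. ennreal (count_prob t n A x))) = sets (future t n)"
    using sets.sets_measure_of_eq[of "future t n"] by simp
  then show ?thesis
    by (simp add: count_kernel_def sets_restr_to_subalg[OF subalgebra_count_sigma])
qed

lemma space_kernel [simp]: "space (count_kernel t n x) = space M"
  using sets_eq_imp_space_eq[OF sets_kernel] by simp

lemma emeasure_kernel:
  assumes A: "A \<in> sets (future t n)"
  shows "emeasure (count_kernel t n x) A = (if x \<in> supp t then ennreal (count_prob t n A x) else emeasure M A)"
proof (cases "x \<in> supp t")
  case True
  have "sigma_algebra (space M) (sets (future t n))"
    using sets.sigma_algebra_axioms[of "future t n"] by simp
  moreover have "positive (sets (future t n)) (\<lambda>A. ennreal (count_prob t n A x))"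
    using count_prob_const[of 0 "{}", OF _ True] by (simp add: positive_def)
  ultimately show ?thesis
    using True by (simp add: count_kernel_def emeasure_measure_of_sigma count_prob_countably_additive A)
qed (simp add: count_kernel_def emeasure_restr_to_subalg[OF subalgebra_count_sigma A])

lemma prob_space_kernel: "prob_space (count_kernel t n x)"
proof (rule prob_spaceI)
  have "space M \<in> sets (future t n)" using sets.top[of "future t n"] by simp
  then show "emeasure (count_kernel t n x) (space (count_kernel t n x)) = 1"
    using count_prob_const[of 1 "space M" x t n] by (simp add: emeasure_kernel emeasure_space_1)
qed

lemma measure_kernel:
  assumes "A \<in> sets (future t n)" "x \<in> supp t"
  shows "measure (count_kernel t n x) A = count_prob t n A x"
  using assms versionD(2)[OF version_count_prob[OF assms(1)]] by (simp add: measure_def emeasure_kernel)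

text \<open>A version of \<open>lam t\<close> that is measurable with respect to the counts alone,
  as the conditioning field of the mixing coefficients demands.\<close>

definition observed_intensity :: "int \<Rightarrow> 'a \<Rightarrow> real" where
  "observed_intensity t \<omega> = intensity (\<lambda>i. N (t - 1 - int i) \<omega>)"

lemma lam_eq_observed: "AE \<omega> in M. lam t \<omega> = observed_intensity t \<omega>"
  unfolding observed_intensity_def by (rule lam_eq_intensity)

lemma borel_measurable_observed:
  "observed_intensity t \<in> borel_measurable (count_sigma M N {..t - 1})"
proof -
  have "(\<lambda>\<omega> i. N (t - 1 - int i) \<omega>) \<in> count_sigma M N {..t - 1} \<rightarrow>\<^sub>M PiM UNIV (\<lambda>_. count_space UNIV)"
    by (intro measurable_PiM_single') (auto intro: measurable_count_sigma)
  from measurable_compose[OF this borel_measurable_intensity] show ?thesis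
    by (simp add: observed_intensity_def[abs_def])
qed

lemma count_sigma_subset_past: "sets (count_sigma M N {..t}) \<subseteq> sets (past t)"
proof (rule sets_count_sigma_subset)
  show "sigma_algebra (space M) (sets (past t))"
    using sets.sigma_algebra_axioms[of "past t"] by simp
  show "\<forall>B. N s -` B \<inter> space M \<in> sets (past t)" if "s \<in> {..t}" for s
    using measurable_sets[OF N_past[of s t]] that by simp
qed

text \<open>The integral identity of a version holds for all past events, in particular for those
  decided by counts. Replacing \<open>lam t\<close> by \<open>observed_intensity t\<close> makes the
  candidate measurable for that smaller field.\<close>

lemma real_cond_exp_count_prob:
  assumes A: "A \<in> sets (future t n)"
  shows "AE \<omega> in M. real_cond_exp M (count_sigma M N {..t - 1}) (indicator A) \<omega> = count_prob t n A (observed_intensity t \<omega>)"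
proof -
  note p = versionD[OF version_count_prob[OF A]]
  note [measurable] = p(1) borel_measurable_observed
  interpret G: sigma_finite_subalgebra M "count_sigma M N {..t - 1}"
    by (intro finite_measure_subalgebra_is_sigma_finite finite_measure_subalgebra.intro
      finite_measure_subalgebra_axioms.intro subalgebra_count_sigma) unfold_locales
  have AM [measurable]: "A \<in> sets M" using A by (rule count_sigma_sets)
  have [measurable]: "observed_intensity t \<in> borel_measurable M"
    using borel_measurable_observed by (rule measurable_from_subalg[OF subalgebra_count_sigma])
  have "(\<integral>\<omega>\<in>D. (indicator A \<omega> :: real) \<partial>M) = (\<integral>\<omega>\<in>D. count_prob t n A (observed_intensity t \<omega>) \<partial>M)"
    if D: "D \<in> sets (count_sigma M N {..t - 1})" for D
  proof -
    have DM [measurable]: "D \<in> sets M" using D by (rule count_sigma_sets)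
    have Dp: "D \<in> sets (past (t - 1))" using D count_sigma_subset_past by auto
    have "(\<integral>\<omega>\<in>D. (indicator A \<omega> :: real) \<partial>M) = (\<integral>\<omega>. indicator (A \<inter> D) \<omega> \<partial>M)"
      unfolding set_lebesgue_integral_def by (intro Bochner_Integration.integral_cong) (auto simp: indicator_def)
    also have "\<dots> = (\<integral>\<omega>. indicator D \<omega> * count_prob t n A (lam t \<omega>) \<partial>M)"
      using p(5)[OF Dp] by simp
    also have "\<dots> = (\<integral>\<omega>. indicator D \<omega> * count_prob t n A (observed_intensity t \<omega>) \<partial>M)"
      by (intro integral_cong_AE) (use lam_eq_observed[of t] in \<open>auto elim!: eventually_mono\<close>)
    finally show ?thesis
      by (simp add: set_lebesgue_integral_def)
  qed
  moreover have "integrable M (indicator A :: 'a \<Rightarrow> real)" by (simp add: emeasure_eq_measure)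
  moreover have "integrable M (\<lambda>\<omega>. count_prob t n A (observed_intensity t \<omega>))"
    by (intro integrable_const_bound[of _ 1]) (use p(2,3) in auto)
  moreover have "(\<lambda>\<omega>. count_prob t n A (observed_intensity t \<omega>)) \<in> borel_measurable (count_sigma M N {..t - 1})"
    by measurable
  ultimately show ?thesis by (rule G.real_cond_exp_charact)
qed

lemma is_reg_cond_prob_kernel:
  "is_reg_cond_prob M (count_sigma M N {..t - 1}) (future t n) (\<lambda>\<omega>. count_kernel t n (observed_intensity t \<omega>))"
  unfolding is_reg_cond_prob_def
proof (intro conjI ballI)
  have "(\<lambda>\<omega>. count_kernel t n (observed_intensity t \<omega>)) \<in> count_sigma M N {..t - 1} \<rightarrow>\<^sub>M subprob_algebra (future t n)"
  proof (rule measurable_subprob_algebra)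
    fix A assume A: "A \<in> sets (future t n)"
    note [measurable] = versionD(1)[OF version_count_prob[OF A]] borel_measurable_observed
    show "(\<lambda>\<omega>. emeasure (count_kernel t n (observed_intensity t \<omega>)) A) \<in> borel_measurable (count_sigma M N {..t - 1})"
      unfolding emeasure_kernel[OF A] by measurable
  qed (auto intro: prob_space_imp_subprob_space prob_space_kernel)
  then show "(\<lambda>\<omega>. count_kernel t n (observed_intensity t \<omega>)) \<in> count_sigma M N {..t - 1} \<rightarrow>\<^sub>M prob_algebra (future t n)"
    by (rule measurable_prob_algebraI[OF prob_space_kernel])
  fix A assume A: "A \<in> sets (future t n)"
  show "AE \<omega> in M. measure (count_kernel t n (observed_intensity t \<omega>)) A = real_cond_exp M (count_sigma M N {..t - 1}) (indicator A) \<omega>"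
    using real_cond_exp_count_prob[OF A] lam_eq_observed[of t] AE_lam_supp[of t]
    by eventually_elim (simp add: measure_kernel[OF A])
qed

text \<open>The generators fix the first few future counts to a given word. Of two words either one
  is a prefix of the other or they are incompatible, so intersections stay in the family, and there
  are only countably many words.\<close>

lemma future_generated_by_words:
  obtains E :: "'a set set" where "countable E" "Int_stable E" "E \<subseteq> Pow (space M)" "space M \<in> E"
    "sets (future t n) = sigma_sets (space M) E"
proof -
  define s where "s = t + int n"
  define W where "W w = {\<omega> \<in> space M. \<forall>i<length w. N (s + int i) \<omega> = w ! i}" for w
  define E where "E = insert {} (range W)"
  have "countable E" by (simp add: E_def)
  moreover have "Int_stable E"
  proof -
    have W_mono: "W v \<subseteq> W w" if "w = take (length w) v" for v w
    proof -
      have "length w \<le> length v" using arg_cong[OF that, of length] by simp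
      moreover have "w ! i = v ! i" if "i < length w" for i using \<open>w = take (length w) v\<close> that by (metis nth_take)
      ultimately show ?thesis unfolding W_def by (intro Collect_mono) (metis less_le_trans)
    qed
    have W_Int: "W v \<inter> W w \<in> E" if le: "length w \<le> length v" for v w
    proof (cases "w = take (length w) v")
      case True
      then have "W v \<inter> W w = W v" using W_mono by blast
      then show ?thesis by (simp add: E_def)
    next
      case False
      have "\<exists>i<length w. w ! i \<noteq> v ! i"
      proof (rule ccontr)
        assume "\<not> ?thesis"
        then have "w = take (length w) v" using le by (intro nth_equalityI) auto
        with False show False ..
      qed
      then obtain i where i: "i < length w" "w ! i \<noteq> v ! i" by blast
      have "\<omega> \<notin> W w" if "\<omega> \<in> W v" for \<omega>
      proof
        assume "\<omega> \<in> W w"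
        then have "N (s + int i) \<omega> = w ! i" using i(1) by (simp add: W_def)
        moreover have "N (s + int i) \<omega> = v ! i" using that i(1) le by (simp add: W_def)
        ultimately show False using i(2) by simp
      qed
      then have "W v \<inter> W w = {}" by blast
      then show ?thesis by (simp add: E_def)
    qed
    have "W v \<inter> W w \<in> E" for v w
      using W_Int[of w v] W_Int[of v w] linear[of "length w" "length v"] by (metis Int_commute)
    moreover have "{} \<in> E" by (simp add: E_def)
    ultimately have "a \<inter> b \<in> E" if "a \<in> insert {} (range W)" "b \<in> insert {} (range W)" for a b
      using that by (metis Int_empty_left Int_empty_right imageE insertE)
    then show ?thesis unfolding Int_stable_def E_def[symmetric] by blast
  qed
  moreover have "E \<subseteq> Pow (space M)" by (auto simp: E_def W_def)
  moreover have "space M \<in> E"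
  proof -
    have "W [] = space M" by (simp add: W_def)
    then show ?thesis unfolding E_def by (metis insertI2 rangeI)
  qed
  moreover have "sets (future t n) = sigma_sets (space M) E"
  proof
    interpret S: sigma_algebra "space M" "sigma_sets (space M) E"
      by (rule sigma_algebra_sigma_sets) fact
    show "sets (future t n) \<subseteq> sigma_sets (space M) E"
    proof (rule sets_count_sigma_subset[OF S.sigma_algebra_axioms], intro allI)
      fix r B assume r: "r \<in> {t + int n..}"
      define i where "i = nat (r - s)"
      have i: "r = s + int i" using r by (simp add: i_def s_def)
      have "N r -` B \<inter> space M = (\<Union>w\<in>{w. length w = Suc i \<and> w ! i \<in> B}. W w)"
      proof (intro equalityI subsetI)
        fix \<omega> assume \<omega>: "\<omega> \<in> N r -` B \<inter> space M"
        define w where "w = map (\<lambda>j. N (s + int j) \<omega>) [0..<Suc i]"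
        have "length w = Suc i" "w ! i \<in> B" "\<omega> \<in> W w"
          using \<omega> by (auto simp: w_def W_def i simp del: upt_Suc)
        then show "\<omega> \<in> (\<Union>w\<in>{w. length w = Suc i \<and> w ! i \<in> B}. W w)" by blast
      next
        fix \<omega> assume "\<omega> \<in> (\<Union>w\<in>{w. length w = Suc i \<and> w ! i \<in> B}. W w)"
        then obtain w where w: "length w = Suc i" "w ! i \<in> B" "\<omega> \<in> W w" by blast
        then have "\<omega> \<in> space M" "N (s + int i) \<omega> = w ! i" by (simp_all add: W_def)
        then show "\<omega> \<in> N r -` B \<inter> space M" using w(2) i by simp
      qed
      also have "\<dots> \<in> sigma_sets (space M) E"
      proof (rule S.countable_UN'')
        show "W w \<in> sigma_sets (space M) E" for w by (rule sigma_sets.Basic) (simp add: E_def)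
      qed simp
      finally show "N r -` B \<inter> space M \<in> sigma_sets (space M) E" .
    qed
    have "W w \<in> sets (future t n)" for w
    proof -
      have "{\<omega> \<in> space (future t n). N (s + int i) \<omega> = w ! i} \<in> sets (future t n)" for i
      proof -
        have "N (s + int i) -` {w ! i} \<inter> space (future t n) \<in> sets (future t n)"
          by (rule measurable_sets[OF measurable_count_sigma]) (simp_all add: s_def)
        moreover have "N (s + int i) -` {w ! i} \<inter> space (future t n) = {\<omega> \<in> space (future t n). N (s + int i) \<omega> = w ! i}"
          by blast
        ultimately show ?thesis by simp
      qed
      then have "{\<omega> \<in> space (future t n). \<forall>i\<in>{..<length w}. N (s + int i) \<omega> = w ! i} \<in> sets (future t n)"
        by (intro sets.sets_Collect_finite_All) auto
      moreover have "{\<omega> \<in> space (future t n). \<forall>i\<in>{..<length w}. N (s + int i) \<omega> = w ! i} = W w"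
        by (auto simp: W_def)
      ultimately show ?thesis by (rule subst[rotated])
    qed
    then have "E \<subseteq> sets (future t n)" unfolding E_def using sets.empty_sets by blast
    then show "sigma_sets (space M) E \<subseteq> sets (future t n)"
      using sets.sigma_sets_subset[of E "future t n"] by simp
  qed
  ultimately show ?thesis by (rule that)
qed

text \<open>Agreement holds almost surely on each event; the countable generator gives one null set
  for all words, and equality of measures follows from the \<open>\<pi>\<close>-system. This makes
  the kernel chosen by \<open>SOME\<close> in the coefficient explicit.\<close>

lemma reg_cond_prob_unique:
  assumes K: "is_reg_cond_prob M (count_sigma M N {..t - 1}) (future t n) K"
  shows "AE \<omega> in M. K \<omega> = count_kernel t n (lam t \<omega>)"
proof -
  obtain E where E: "countable E" "Int_stable E" "E \<subseteq> Pow (space M)" "space M \<in> E"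
    "sets (future t n) = sigma_sets (space M) E" by (rule future_generated_by_words)
  have KA: "AE \<omega> in M. measure (K \<omega>) A = measure (count_kernel t n (lam t \<omega>)) A" if A: "A \<in> E" for A
  proof -
    have AH: "A \<in> sets (future t n)" using A E(5) by auto
    then have "AE \<omega> in M. measure (K \<omega>) A = real_cond_exp M (count_sigma M N {..t - 1}) (indicator A) \<omega>"
      using K by (auto simp: is_reg_cond_prob_def)
    then show ?thesis
      using real_cond_exp_count_prob[OF AH] lam_eq_observed[of t] AE_lam_supp[of t]
      by eventually_elim (simp add: measure_kernel[OF AH])
  qed
  have "AE \<omega> in M. \<forall>A\<in>E. measure (K \<omega>) A = measure (count_kernel t n (lam t \<omega>)) A"
    using KA by (simp add: AE_ball_countable[OF E(1)])
  then show ?thesis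
  proof (rule AE_mp, intro AE_I2 impI)
    fix \<omega> assume \<omega>: "\<omega> \<in> space M" and eq: "\<forall>A\<in>E. measure (K \<omega>) A = measure (count_kernel t n (lam t \<omega>)) A"
    have "K \<in> count_sigma M N {..t - 1} \<rightarrow>\<^sub>M prob_algebra (future t n)"
      using K by (simp add: is_reg_cond_prob_def)
    from measurable_space[OF this, of \<omega>] \<omega>
    have K': "prob_space (K \<omega>)" "sets (K \<omega>) = sets (future t n)"
      by (auto simp: space_prob_algebra)
    interpret K: prob_space "K \<omega>" by fact
    interpret L: prob_space "count_kernel t n (lam t \<omega>)" by (rule prob_space_kernel)
    show "K \<omega> = count_kernel t n (lam t \<omega>)"
    proof (rule measure_eqI_generator_eq[OF E(2,3), where A = "\<lambda>_. space M"])
      show "emeasure (K \<omega>) X = emeasure (count_kernel t n (lam t \<omega>)) X" if "X \<in> E" for X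
        using eq that by (simp add: K.emeasure_eq_measure L.emeasure_eq_measure)
    qed (use K' E in \<open>auto simp: K.emeasure_eq_measure\<close>)
  qed
qed

text \<open>With the whole space as past event, the probability of \<open>A\<close> is the mean of
  \<open>p (lam t)\<close>. The Lipschitz bound is averaged over \<open>lam t\<close>, using |x - y|
  <= x + y for nonnegative intensities and a mean that does not depend on time.\<close>

lemma mixing_bound:
  assumes p: "version t (supp t) c A p" and x: "x \<in> supp t" "0 \<le> x"
  shows "\<bar>p x - measure M (A \<inter> space M)\<bar> \<le> c * (x + (\<integral>\<omega>. lam 1 \<omega> \<partial>M))"
proof -
  note [measurable] = versionD(1)[OF p]
  have top: "space M \<in> sets (past (t - 1))" using sets.top[of "past (t - 1)"] by simp
  have int: "integrable M (\<lambda>\<omega>. p (lam t \<omega>))"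
    by (intro integrable_const_bound[of _ 1]) (use versionD(2,3)[OF p] in auto)
  have "measure M (A \<inter> space M) = (\<integral>\<omega>. p (lam t \<omega>) \<partial>M)"
    unfolding versionD(5)[OF p top] by (intro Bochner_Integration.integral_cong) auto
  then have "p x - measure M (A \<inter> space M) = (\<integral>\<omega>. p x - p (lam t \<omega>) \<partial>M)"
    using int by (simp add: prob_space)
  also have "\<bar>\<dots>\<bar> \<le> (\<integral>\<omega>. \<bar>p x - p (lam t \<omega>)\<bar> \<partial>M)" by (rule integral_abs_bound)
  also have "\<dots> \<le> (\<integral>\<omega>. c * (x + lam t \<omega>) \<partial>M)"
  proof (intro integral_mono_AE)
    show "AE \<omega> in M. \<bar>p x - p (lam t \<omega>)\<bar> \<le> c * (x + lam t \<omega>)"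
      using AE_lam_supp[of t]
    proof (rule AE_mp, intro AE_I2 impI)
      fix \<omega> assume \<omega>: "\<omega> \<in> space M" and "lam t \<omega> \<in> supp t"
      then have "\<bar>p x - p (lam t \<omega>)\<bar> \<le> c * \<bar>x - lam t \<omega>\<bar>"
        using lipschitz_onD[OF versionD(4)[OF p] x(1)] by (simp add: dist_real_def)
      also have "\<dots> \<le> c * (x + lam t \<omega>)"
        using lam_nonneg[OF \<omega>, of t] x(2) lipschitz_on_nonneg[OF versionD(4)[OF p]] by (intro mult_left_mono) auto
      finally show "\<bar>p x - p (lam t \<omega>)\<bar> \<le> c * (x + lam t \<omega>)" .
    qed
  qed (use int integrable_lam in auto)
  also have "\<dots> = c * (x + (\<integral>\<omega>. lam 1 \<omega> \<partial>M))"
    using integrable_lam[of t] expectation_lam[of t 1] by (simp add: prob_space)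
  finally show ?thesis .
qed

text \<open>At almost every outcome the bound holds for all \<open>A\<close> at once, so it survives
  the supremum; the mean of \<open>lam 1 + E\<close> is \<open>2 * E\<close>.\<close>

lemma beta_coeff_le:
  assumes "1 \<le> n"
  shows "beta_coeff M N n \<le> ennreal (2 * (\<integral>\<omega>. lam 1 \<omega> \<partial>M) * rate (n - 1))"
proof -
  define G where "G = count_sigma M N {..0}"
  define H where "H = count_sigma M N {int n..}"
  define K where "K = (SOME K. is_reg_cond_prob M G H K)"
  \<comment> \<open>Conditioning on the counts up to time 0 fixes the intensity at time 1, from
    which time \<open>n\<close> is \<open>n - 1\<close> steps away.\<close>
  obtain m where m: "n = Suc m" using assms by (cases n) auto
  define c where "c = rate m"
  define E where "E = (\<integral>\<omega>. lam 1 \<omega> \<partial>M)"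
  have n: "1 + int m = int n" using m by simp
  have "is_reg_cond_prob M G H (\<lambda>\<omega>. count_kernel 1 m (observed_intensity 1 \<omega>))"
    using is_reg_cond_prob_kernel[of 1 m] by (simp only: n G_def H_def) simp
  then have "is_reg_cond_prob M G H K" unfolding K_def by (rule someI[of "is_reg_cond_prob M G H"])
  then have K: "AE \<omega> in M. K \<omega> = count_kernel 1 m (lam 1 \<omega>)"
    using reg_cond_prob_unique[of 1 m K] by (simp only: n G_def H_def) simp
  have c: "0 \<le> c" by (simp add: c_def rate_nonneg)
  have E: "0 \<le> E" unfolding E_def by (intro integral_nonneg_AE AE_I2 lam_nonneg)
  have "beta_coeff M N n = (\<integral>\<^sup>+ \<omega>. (\<Squnion>A\<in>sets H. ennreal \<bar>measure (K \<omega>) A - measure M A\<bar>) \<partial>M)"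
    by (simp add: beta_coeff_def abs_reg_coeff_def G_def H_def K_def)
  also have "\<dots> \<le> (\<integral>\<^sup>+ \<omega>. ennreal (c * (lam 1 \<omega> + E)) \<partial>M)"
  proof (rule nn_integral_mono_AE)
    show "AE \<omega> in M. (\<Squnion>A\<in>sets H. ennreal \<bar>measure (K \<omega>) A - measure M A\<bar>) \<le> ennreal (c * (lam 1 \<omega> + E))"
      using AE_space K AE_lam_supp[of 1]
    proof eventually_elim
      case (elim \<omega>)
      show ?case
      proof (intro SUP_least ennreal_leI)
        fix A assume "A \<in> sets H"
        then have A: "A \<in> sets (future 1 m)" by (simp only: n H_def)
        have "A \<inter> space M = A" using sets.sets_into_space[OF A] by auto
        then show "\<bar>measure (K \<omega>) A - measure M A\<bar> \<le> c * (lam 1 \<omega> + E)"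
          using mixing_bound[OF version_count_prob[OF A] elim(3) lam_nonneg[OF elim(1)]] elim
          by (simp add: measure_kernel[OF A] c_def E_def)
      qed
    qed
  qed
  also have "\<dots> = ennreal (\<integral>\<omega>. c * (lam 1 \<omega> + E) \<partial>M)"
    by (intro nn_integral_eq_integral) (auto simp: integrable_lam lam_nonneg c E intro!: AE_I2)
  also have "(\<integral>\<omega>. c * (lam 1 \<omega> + E) \<partial>M) = 2 * E * c"
    by (simp add: integrable_lam prob_space E_def)
  finally show ?thesis by (simp add: c_def E_def m)
qed

end

section \<open>Increasing unions of \<sigma>-algebras and iterated shifts\<close>

lemma algebra_UN_sigma_algebras:
  fixes S :: "nat \<Rightarrow> 'a set set"
  assumes S: "\<And>i. sigma_algebra X (S i)" and mono: "\<And>i j. i \<le> j \<Longrightarrow> S i \<subseteq> S j"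
  shows "algebra X (\<Union>i. S i)"
  unfolding algebra_iff_Un
proof (intro conjI ballI)
  have "S i \<subseteq> Pow X" for i using S[of i] by (simp add: sigma_algebra_iff2)
  then show "(\<Union>i. S i) \<subseteq> Pow X" by (rule UN_least)
  show "{} \<in> (\<Union>i. S i)" using S[of 0] by (auto simp: sigma_algebra_iff2)
  show "X - A \<in> (\<Union>i. S i)" if A: "A \<in> (\<Union>i. S i)" for A
  proof -
    obtain i where "A \<in> S i" using A by blast
    then have "X - A \<in> S i" using S[of i] by (simp add: sigma_algebra_iff2)
    then show ?thesis by blast
  qed
  show "A \<union> B \<in> (\<Union>i. S i)" if "A \<in> (\<Union>i. S i)" "B \<in> (\<Union>i. S i)" for A B
  proof -
    obtain i j where "A \<in> S i" "B \<in> S j" using \<open>A \<in> _\<close> \<open>B \<in> _\<close> by blast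
    then have AB: "A \<in> S (max i j)" "B \<in> S (max i j)"
      using mono[of i "max i j"] mono[of j "max i j"] by auto
    interpret sigma_algebra X "S (max i j)" by (rule S)
    have "A \<union> B \<in> S (max i j)" using AB by (rule Un)
    then show ?thesis by blast
  qed
qed

lemma shift_path_invariant:
  assumes "shift_path 1 -` A = A"
  shows "shift_path (int h) -` A = A"
proof (induction h)
  case 0 then show ?case by (auto simp: shift_path_def)
next
  case (Suc h)
  have "shift_path (int (Suc h)) x = shift_path (int h) (shift_path 1 x)" for x :: "int \<Rightarrow> 'a"
    by (auto simp: shift_path_def algebra_simps)
  then have "shift_path (int (Suc h)) -` A = shift_path 1 -` (shift_path (int h) -` A)"
    by (auto simp: vimage_def)
  then show ?case using Suc assms by simp
qed

context contractive_poisson_process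
begin

section \<open>Ergodicity\<close>

abbreviation coord_count :: "int \<Rightarrow> (int \<Rightarrow> nat \<times> real) \<Rightarrow> nat" where
  "coord_count t x \<equiv> fst (x t)"

abbreviation path_counts :: "int set \<Rightarrow> (int \<Rightarrow> nat \<times> real) measure" where
  "path_counts I \<equiv> count_sigma path_space coord_count I"

lemma measurable_coord_count: "coord_count t \<in> path_space \<rightarrow>\<^sub>M count_space UNIV"
  unfolding path_space_def by measurable

lemma path_counts_sets:
  assumes E: "E \<in> sets (path_counts I)"
  shows "E \<in> sets path_space"
proof -
  have "sets (path_counts I) \<subseteq> sets path_space"
  proof (rule sets_count_sigma_subset[OF sets.sigma_algebra_axioms], intro allI)
    show "coord_count s -` B \<inter> space path_space \<in> sets path_space" for s B
      by (rule measurable_sets[OF measurable_coord_count]) simp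
  qed
  then show ?thesis using E by (rule subsetD)
qed

lemma shifted_path_count_sigma:
  assumes E: "E \<in> sets (path_counts {s..})"
  shows "(\<lambda>\<omega>. shift_path h (path \<omega>)) -` E \<inter> space M \<in> sets (count_sigma M N {s + h..})"
proof -
  have "(\<lambda>\<omega>. shift_path h (path \<omega>)) \<in> count_sigma M N {s + h..} \<rightarrow>\<^sub>M path_counts {s..}"
  proof (rule measurable_sigma_sets[OF sets_count_sigma])
    fix y assume "y \<in> {coord_count r -` B \<inter> space path_space | r B. r \<in> {s..}}"
    then obtain r B where y: "y = coord_count r -` B" "s \<le> r" by auto
    have "(\<lambda>\<omega>. shift_path h (path \<omega>)) -` y \<inter> space (count_sigma M N {s + h..}) = N (r + h) -` B \<inter> space (count_sigma M N {s + h..})"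
      by (auto simp: y shift_path_def path_def)
    also have "\<dots> \<in> sets (count_sigma M N {s + h..})"
      using y(2) by (intro measurable_sets[OF measurable_count_sigma]) auto
    finally show "(\<lambda>\<omega>. shift_path h (path \<omega>)) -` y \<inter> space (count_sigma M N {s + h..}) \<in> sets (count_sigma M N {s + h..})" .
  qed auto
  from measurable_sets[OF this E] show ?thesis by simp
qed

lemma measure_shifted_path:
  assumes [measurable]: "E \<in> sets path_space"
  shows "measure M ((\<lambda>\<omega>. shift_path h (path \<omega>)) -` E \<inter> space M) = measure M (path -` E \<inter> space M)"
proof -
  have "measure (distr M path_space (\<lambda>\<omega>. shift_path h (path \<omega>))) E = measure (distr M path_space path) E"
    by (simp add: path_stationary)
  then show ?thesis by (simp add: measure_distr)
qed

text \<open>Integrating the pointwise estimate over \<open>D\<close> gives a bound that is uniform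
  in both events; this is the form of mixing from which ergodicity follows.\<close>

lemma past_future_mixing:
  assumes D: "D \<in> sets (past (t - 1))" and F: "F \<in> sets (future t n)"
  shows "\<bar>measure M (F \<inter> D) - measure M F * measure M D\<bar> \<le> rate n * (2 * (\<integral>\<omega>. lam 1 \<omega> \<partial>M))"
proof -
  define E where "E = (\<integral>\<omega>. lam 1 \<omega> \<partial>M)"
  note v = version_count_prob[OF F] and p = versionD[OF version_count_prob[OF F]]
  note [measurable] = p(1)
  have DM [measurable]: "D \<in> sets M" using D by (rule past_sets)
  have "F \<inter> space M = F" using sets.sets_into_space[OF F] by auto
  then have close: "\<bar>count_prob t n F x - measure M F\<bar> \<le> rate n * (x + E)" if "x \<in> supp t" "0 \<le> x" for x
    using mixing_bound[OF v that] by (simp add: E_def)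
  have int: "integrable M (\<lambda>\<omega>. indicator D \<omega> * count_prob t n F (lam t \<omega>))"
    by (intro integrable_indicator_bounded) (auto simp: p)
  have int': "integrable M (\<lambda>\<omega>. indicator D \<omega> * measure M F)"
    by (intro integrable_mult_left integrable_real_indicator) (auto simp: emeasure_eq_measure)
  have "measure M (F \<inter> D) - measure M F * measure M D
      = (\<integral>\<omega>. indicator D \<omega> * count_prob t n F (lam t \<omega>) \<partial>M) - (\<integral>\<omega>. indicator D \<omega> * measure M F \<partial>M)"
    using p(5)[OF D] by simp
  also have "\<dots> = (\<integral>\<omega>. indicator D \<omega> * count_prob t n F (lam t \<omega>) - indicator D \<omega> * measure M F \<partial>M)"
    by (rule Bochner_Integration.integral_diff[OF int int', symmetric])
  also have "\<bar>\<dots>\<bar> \<le> (\<integral>\<omega>. \<bar>indicator D \<omega> * count_prob t n F (lam t \<omega>) - indicator D \<omega> * measure M F\<bar> \<partial>M)"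
    by (rule integral_abs_bound)
  also have "\<dots> \<le> (\<integral>\<omega>. rate n * (lam t \<omega> + E) \<partial>M)"
  proof (rule integral_mono_AE)
    show "AE \<omega> in M. \<bar>indicator D \<omega> * count_prob t n F (lam t \<omega>) - indicator D \<omega> * measure M F\<bar> \<le> rate n * (lam t \<omega> + E)"
      using AE_space AE_lam_supp[of t]
    proof eventually_elim
      case (elim \<omega>)
      then show ?case
        using close[OF elim(2) lam_nonneg] by (auto simp: indicator_def)
    qed
  qed (use int int' integrable_lam in auto)
  also have "\<dots> = rate n * (2 * E)"
    using integrable_lam[of t] expectation_lam[of t 1] by (simp add: prob_space E_def)
  finally show ?thesis by (simp add: E_def)
qed

lemma rate_tendsto_0: "rate \<longlonglongrightarrow> 0"
proof -
  have "(\<lambda>n. (\<kappa>\<^sub>1 + \<kappa>\<^sub>2) ^ n / (1 - \<kappa>\<^sub>1)) \<longlonglongrightarrow> 0 / (1 - \<kappa>\<^sub>1)"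
    using k1_nonneg k2_nonneg contractive k1_less_1
    by (intro tendsto_divide LIMSEQ_power_zero tendsto_const) auto
  then show ?thesis by (simp add: rate_def[abs_def])
qed

text \<open>\<open>\<Theta>\<close> rebuilds a path from its counts and, since there are countably
  many times, almost surely fixes the whole observed path. The preimage under
  \<open>\<Theta>\<close> is then a count event, to which mixing of the counts can be
  applied.\<close>

lemma path_determined_by_counts:
  assumes A: "A \<in> sets path_space"
  obtains A' where "A' \<in> sets (path_counts UNIV)"
    "AE \<omega> in M. path \<omega> \<in> A' \<longleftrightarrow> path \<omega> \<in> A"
proof -
  define \<Theta> :: "(int \<Rightarrow> nat \<times> real) \<Rightarrow> int \<Rightarrow> nat \<times> real" where
    "\<Theta> x = (\<lambda>t. (coord_count t x, intensity (\<lambda>i. coord_count (t - 1 - int i) x)))" for x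
  have \<Theta>: "\<Theta> \<in> path_counts UNIV \<rightarrow>\<^sub>M path_space"
    unfolding \<Theta>_def path_space_def
  proof (intro measurable_PiM_single' measurable_Pair)
    fix t
    show "coord_count t \<in> count_sigma (PiM UNIV (\<lambda>_. count_space UNIV \<Otimes>\<^sub>M borel)) coord_count UNIV \<rightarrow>\<^sub>M count_space UNIV"
      by (rule measurable_count_sigma) simp
    have "(\<lambda>x i. coord_count (t - 1 - int i) x) \<in> path_counts UNIV \<rightarrow>\<^sub>M PiM UNIV (\<lambda>_. count_space UNIV)"
      by (intro measurable_PiM_single') (auto intro: measurable_count_sigma)
    from measurable_compose[OF this borel_measurable_intensity]
    show "(\<lambda>x. intensity (\<lambda>i. coord_count (t - 1 - int i) x))
        \<in> borel_measurable (count_sigma (PiM UNIV (\<lambda>_. count_space UNIV \<Otimes>\<^sub>M borel)) coord_count UNIV)"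
      by (simp add: path_space_def)
  qed (auto simp: space_pair_measure)
  have "AE \<omega> in M. \<forall>t. lam t \<omega> = intensity (\<lambda>i. N (t - 1 - int i) \<omega>)"
    using lam_eq_intensity by (simp add: AE_all_countable)
  then have "AE \<omega> in M. path \<omega> \<in> \<Theta> -` A \<longleftrightarrow> path \<omega> \<in> A"
  proof (rule AE_mp, intro AE_I2 impI)
    fix \<omega> assume "\<forall>t. lam t \<omega> = intensity (\<lambda>i. N (t - 1 - int i) \<omega>)"
    then have "\<Theta> (path \<omega>) = path \<omega>" by (auto simp: \<Theta>_def path_def)
    then show "path \<omega> \<in> \<Theta> -` A \<longleftrightarrow> path \<omega> \<in> A" by simp
  qed
  moreover have "\<Theta> -` A \<in> sets (path_counts UNIV)"
    using measurable_sets[OF \<Theta> A] by simp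
  ultimately show ?thesis using that by blast
qed

text \<open>An approximating event that uses the counts from some time \<open>-m\<close> on can be
  shifted arbitrarily far into the future: invariance keeps it close to the same event, and mixing
  makes it nearly independent of \<open>D\<close>.\<close>

lemma invariant_independent_of_past:
  assumes A: "A \<in> sets path_space" and inv: "shift_path 1 -` A = A" and D: "D \<in> sets (past (t - 1))"
  shows "measure M (path -` A \<inter> space M \<inter> D) = measure M (path -` A \<inter> space M) * measure M D"
proof -
  define B where "B = path -` A \<inter> space M"
  define C where "C = 2 * (\<integral>\<omega>. lam 1 \<omega> \<partial>M)"
  have C: "0 \<le> C" by (auto simp: C_def intro!: integral_nonneg_AE AE_I2 lam_nonneg)
  have B [measurable]: "B \<in> sets M" unfolding B_def by (rule measurable_sets[OF measurable_path A])
  have DM [measurable]: "D \<in> sets M" using D by (rule past_sets)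
  have "\<bar>measure M (B \<inter> D) - measure M B * measure M D\<bar> \<le> 0"
  proof (rule field_le_epsilon)
    fix e :: real assume e: "0 < e"
    obtain A' where A': "A' \<in> sets (path_counts UNIV)" "AE \<omega> in M. path \<omega> \<in> A' \<longleftrightarrow> path \<omega> \<in> A"
      using path_determined_by_counts[OF A] by blast
    have A'm [measurable]: "A' \<in> sets path_space" using A'(1) by (rule path_counts_sets)
    interpret P: prob_space "distr M path_space path" by (rule prob_space_distr[OF measurable_path])
    let ?S = "\<lambda>m::nat. sets (path_counts {- int m..})"
    have "\<exists>E\<in>(\<Union>m. ?S m). measure (distr M path_space path) (sym_diff A' E) < e / 3"
    proof (rule P.approximate_by_algebra)
      show "algebra (space (distr M path_space path)) (\<Union>m. ?S m)"
        unfolding space_distr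
      proof (rule algebra_UN_sigma_algebras)
        show "sigma_algebra (space path_space) (?S i)" for i
          using sets.sigma_algebra_axioms[of "path_counts {- int i..}"] unfolding space_count_sigma .
        show "?S i \<subseteq> ?S j" if "i \<le> j" for i j
          by (rule sets_count_sigma_mono) (use that in auto)
      qed
      show "(\<Union>m. ?S m) \<subseteq> sets (distr M path_space path)"
        unfolding sets_distr using path_counts_sets by blast
      \<comment> \<open>Coordinate \<open>s\<close> belongs to the half-line that starts at
        \<open>-\<bar>s\<bar>\<close>, so the fields of the half-lines generate all count
        events.\<close>
      have "sets (path_counts UNIV) \<subseteq> sigma_sets UNIV (\<Union>m. ?S m)"
      proof (rule sets_count_sigma_subset, goal_cases)
        case 1 show ?case unfolding space_path_space by (rule sigma_algebra_sigma_sets) simp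
      next
        case (2 s)
        have "coord_count s \<in> path_counts {- int (nat \<bar>s\<bar>)..} \<rightarrow>\<^sub>M count_space UNIV"
          by (rule measurable_count_sigma) auto
        then have "coord_count s -` B \<inter> space path_space \<in> ?S (nat \<bar>s\<bar>)" for B
          using measurable_sets[of "coord_count s" "path_counts {- int (nat \<bar>s\<bar>)..}" "count_space UNIV" B]
          unfolding space_count_sigma by (metis UNIV_I sets_count_space Pow_UNIV)
        then show ?case by blast
      qed
      then show "A' \<in> sigma_sets (space (distr M path_space path)) (\<Union>m. ?S m)"
        using A'(1) unfolding space_distr space_path_space by (rule subsetD)
      show "0 < e / 3" using e by simp
    qed
    then obtain E m where E: "E \<in> ?S m" "measure (distr M path_space path) (sym_diff A' E) < e / 3" by blast
    have Em [measurable]: "E \<in> sets path_space" using E(1) by (rule path_counts_sets)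
    obtain n where n: "rate n * C < e / 3"
    proof -
      have "(\<lambda>n. rate n * C) \<longlonglongrightarrow> 0 * C" by (intro tendsto_mult rate_tendsto_0 tendsto_const)
      then have "eventually (\<lambda>n. rate n * C < e / 3) sequentially" using e by (intro order_tendstoD) auto
      then show ?thesis using that by (auto simp: eventually_sequentially)
    qed
    \<comment> \<open>Shifting by \<open>h\<close> moves the window start \<open>-m\<close> to
      \<open>t + n\<close> or later, which is the gap that the mixing bound requires.\<close>
    define h where "h = nat (t + int n + int m)"
    define F where "F = (\<lambda>\<omega>. shift_path (int h) (path \<omega>)) -` E \<inter> space M"
    have F: "F \<in> sets (future t n)"
    proof -
      have "F \<in> sets (count_sigma M N {- int m + int h..})"
        unfolding F_def by (rule shifted_path_count_sigma[OF E(1)])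
      then show ?thesis
        by (rule subsetD[OF sets_count_sigma_mono, rotated]) (auto simp: h_def)
    qed
    then have FM [measurable]: "F \<in> sets M" by (rule count_sigma_sets)
    have BF: "measure M (sym_diff B F) < e / 3"
    proof -
      \<comment> \<open>Invariance writes \<open>B\<close> with the same shift as \<open>F\<close>,
        and stationarity then removes the shift from the symmetric difference, so the error does not
        grow with \<open>h\<close>.\<close>
      have "B = (\<lambda>\<omega>. shift_path (int h) (path \<omega>)) -` A \<inter> space M"
        using shift_path_invariant[OF inv, of h] by (auto simp: B_def)
      then have "sym_diff B F = (\<lambda>\<omega>. shift_path (int h) (path \<omega>)) -` (sym_diff A E) \<inter> space M"
        by (auto simp: F_def)
      then have "measure M (sym_diff B F) = measure M (path -` (sym_diff A E) \<inter> space M)"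
        using A Em by (simp only: measure_shifted_path sets.Un sets.Diff)
      also have "\<dots> = measure M (path -` (sym_diff A' E) \<inter> space M)"
        using A by (intro measure_eq_AE) (use A'(2) in \<open>auto elim!: eventually_mono\<close>)
      also have "\<dots> < e / 3" using E(2) by (subst (asm) measure_distr) auto
      finally show ?thesis .
    qed
    have "\<bar>measure M (B \<inter> D) - measure M (F \<inter> D)\<bar> < e / 3"
      using measure_sym_diff_bound[OF finite_measure_axioms B FM DM] BF by linarith
    moreover have "\<bar>measure M (F \<inter> D) - measure M F * measure M D\<bar> < e / 3"
      using past_future_mixing[OF D F] n by (simp add: C_def)
    moreover have "\<bar>measure M F * measure M D - measure M B * measure M D\<bar> < e / 3"
    proof -
      have "\<bar>measure M (B \<inter> space M) - measure M (F \<inter> space M)\<bar> < e / 3"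
        using measure_sym_diff_bound[OF finite_measure_axioms B FM sets.top] BF by linarith
      then have "\<bar>measure M F - measure M B\<bar> < e / 3" by (simp add: abs_minus_commute)
      moreover have "\<bar>measure M F * measure M D - measure M B * measure M D\<bar> \<le> \<bar>measure M F - measure M B\<bar> * 1"
        unfolding left_diff_distrib[symmetric] abs_mult by (intro mult_left_mono) auto
      ultimately show ?thesis by simp
    qed
    ultimately show "\<bar>measure M (B \<inter> D) - measure M B * measure M D\<bar> \<le> 0 + e" by linarith
  qed
  then show ?thesis by (simp add: B_def)
qed

text \<open>Each coordinate of the path is measurable for some past field, so \<open>B\<close> is
  approximated by past events \<open>D\<close>. In the limit the product rule for \<open>B\<close>
  and \<open>D\<close> becomes an equation between the probability of \<open>B\<close> and its
  square.\<close>

lemma invariant_trivial: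
  assumes A: "A \<in> sets path_space" and inv: "shift_path 1 -` A = A"
  shows "measure M (path -` A \<inter> space M) = 0 \<or> measure M (path -` A \<inter> space M) = 1"
proof -
  define B where "B = path -` A \<inter> space M"
  have B [measurable]: "B \<in> sets M" unfolding B_def by (rule measurable_sets[OF measurable_path A])
  let ?S = "\<lambda>j::nat. sets (past (int j))"
  define G where "G = sigma (space M) (\<Union>j. ?S j)"
  have sub: "(\<Union>j. ?S j) \<subseteq> Pow (space M)"
    using past_sets sets.sets_into_space by blast
  have G: "space G = space M" "sets G = sigma_sets (space M) (\<Union>j. ?S j)"
    using sub by (auto simp: G_def space_measure_of_conv)
  have sub_G: "subalgebra G (past (int j))" for j
    by (auto simp: subalgebra_def G)
  have "path \<in> G \<rightarrow>\<^sub>M path_space"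
    unfolding path_def path_space_def
  proof (intro measurable_PiM_single' measurable_Pair)
    fix t :: int
    show "N t \<in> G \<rightarrow>\<^sub>M count_space UNIV"
      by (rule measurable_from_subalg[OF sub_G[of "nat t"]], rule N_past) simp
    show "lam t \<in> borel_measurable G"
      by (rule measurable_from_subalg[OF sub_G[of "nat t"]], rule lam_past) simp
  qed (auto simp: space_pair_measure)
  then have BG: "B \<in> sigma_sets (space M) (\<Union>j. ?S j)"
    using measurable_sets[of path G path_space A] A unfolding G B_def by blast
  have "\<bar>measure M B - measure M B * measure M B\<bar> \<le> 0"
  proof (rule field_le_epsilon)
    fix e :: real assume e: "0 < e"
    have "\<exists>D\<in>(\<Union>j. ?S j). measure M (sym_diff B D) < e / 2"
    proof (rule approximate_by_algebra[OF _ _ BG])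
      show "algebra (space M) (\<Union>j. ?S j)"
      proof (rule algebra_UN_sigma_algebras)
        show "sigma_algebra (space M) (?S i)" for i
          using sets.sigma_algebra_axioms[of "past (int i)"] unfolding space_past_sigma .
        show "?S i \<subseteq> ?S j" if "i \<le> j" for i j
          by (rule sets_past_sigma_mono) (use that in simp)
      qed
      show "(\<Union>j. ?S j) \<subseteq> sets M" using past_sets by blast
      show "0 < e / 2" using e by simp
    qed
    then obtain D j where D: "D \<in> sets (past (int j))" "measure M (sym_diff B D) < e / 2" by blast
    have DM [measurable]: "D \<in> sets M" using D(1) by (rule past_sets)
    have "measure M (B \<inter> D) = measure M B * measure M D"
      unfolding B_def by (rule invariant_independent_of_past[OF A inv, of D "int j + 1"]) (use D in simp)
    moreover have "\<bar>measure M B - measure M (B \<inter> D)\<bar> < e / 2"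
      using measure_sym_diff_bound[OF finite_measure_axioms B DM B] D(2) by (simp add: Int_commute)
    moreover have "\<bar>measure M B * measure M D - measure M B * measure M B\<bar> \<le> 1 * \<bar>measure M D - measure M B\<bar>"
      unfolding right_diff_distrib[symmetric] abs_mult by (intro mult_right_mono) auto
    moreover have "\<bar>measure M D - measure M B\<bar> < e / 2"
      using measure_sym_diff_bound[OF finite_measure_axioms B DM sets.top] D(2) by (simp add: abs_minus_commute)
    \<comment> \<open>Products of measures are abstracted to variables, which leaves a purely linear
      inequality.\<close>
    moreover have "\<bar>b - p\<bar> \<le> 0 + e"
      if "q = r" "\<bar>b - q\<bar> < e / 2" "\<bar>r - p\<bar> \<le> 1 * d" "d < e / 2" for b p q r d
      using that by linarith
    ultimately show "\<bar>measure M B - measure M B * measure M B\<bar> \<le> 0 + e" by blast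
  qed
  then have "measure M B * (1 - measure M B) = 0" by (simp add: algebra_simps)
  then show ?thesis by (auto simp: B_def)
qed

lemma ergodic: "ergodic_process M N lam"
  unfolding ergodic_process_def
proof (intro ballI impI)
  fix A assume A: "A \<in> sets path_space" and inv: "shift_path 1 -` A \<inter> space path_space = A"
  have "emeasure (path_law M N lam) A = ennreal (measure M (path -` A \<inter> space M))"
    using A by (simp add: path_law_eq emeasure_distr emeasure_eq_measure)
  then show "emeasure (path_law M N lam) A = 0 \<or> emeasure (path_law M N lam) A = 1"
    using invariant_trivial[OF A] inv by auto
qed

lemma absolutely_regular_counts: "absolutely_regular M N"
  unfolding absolutely_regular_def
proof (rule tendsto_sandwich[OF _ _ tendsto_const])
  define C where "C = 2 * (\<integral>\<omega>. lam 1 \<omega> \<partial>M)"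
  show "eventually (\<lambda>n. beta_coeff M N n \<le> ennreal (C * rate (n - 1))) sequentially"
    using eventually_ge_at_top[of 1] by eventually_elim (unfold C_def, rule beta_coeff_le)
  have "(\<lambda>n. C * rate n) \<longlonglongrightarrow> C * 0" by (intro tendsto_mult tendsto_const rate_tendsto_0)
  then have "(\<lambda>n. ennreal (C * rate n)) \<longlonglongrightarrow> 0"
    using tendsto_ennrealI by fastforce
  \<comment> \<open>Dropping the first term of the sequence aligns \<open>n - 1\<close> with
    \<open>n\<close>.\<close>
  then show "(\<lambda>n. ennreal (C * rate (n - 1))) \<longlonglongrightarrow> 0"
    by (subst filterlim_sequentially_Suc[symmetric]) simp
qed simp

end

theorem theorem3p1:
  fixes M :: "'a measure"
    and N :: "int \<Rightarrow> 'a \<Rightarrow> nat"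
    and lam :: "int \<Rightarrow> 'a \<Rightarrow> real"
    and f :: "real \<Rightarrow> nat \<Rightarrow> real"
    and \<kappa>\<^sub>1 \<kappa>\<^sub>2 :: real
  assumes "prob_space M"
    and f_nonneg: "\<And>x y. x \<ge> 0 \<Longrightarrow> f x y \<ge> 0"
    and f_lip: "\<And>x x' y y'. x \<ge> 0 \<Longrightarrow> x' \<ge> 0 \<Longrightarrow>
          \<bar>f x y - f x' y'\<bar> \<le> \<kappa>\<^sub>1 * \<bar>x - x'\<bar> + \<kappa>\<^sub>2 * \<bar>real y - real y'\<bar>"
    and "\<kappa>\<^sub>1 \<ge> 0" and "\<kappa>\<^sub>2 \<ge> 0" and "\<kappa>\<^sub>1 + \<kappa>\<^sub>2 < 1"
    and N_meas: "\<And>t. N t \<in> measurable M (count_space UNIV)"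
    and lam_meas: "\<And>t. lam t \<in> borel_measurable M"
    and lam_nonneg: "\<And>t \<omega>. \<omega> \<in> space M \<Longrightarrow> lam t \<omega> \<ge> 0"
    and stat: "strictly_stationary M N lam"
    and poisson: "\<And>t k. AE \<omega> in M.
          real_cond_exp M (past_sigma M N lam (t - 1)) (indicator {\<omega>\<in>space M. N t \<omega> = k}) \<omega>
            = exp (- lam t \<omega>) * lam t \<omega> ^ k / fact k"
    and recursion: "\<And>t \<omega>. \<omega> \<in> space M \<Longrightarrow> lam t \<omega> = f (lam (t - 1) \<omega>) (N (t - 1) \<omega>)"
  shows "absolutely_regular M N
       \<and> (\<forall>n\<ge>1. beta_coeff M N n \<le>
            ennreal (2 * (\<integral>\<omega>. lam 1 \<omega> \<partial>M) * (\<kappa>\<^sub>1 + \<kappa>\<^sub>2) ^ (n - 1) / (1 - \<kappa>\<^sub>1)))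
       \<and> (\<exists>g. g \<in> borel_measurable (PiM (UNIV :: nat set) (\<lambda>_. count_space (UNIV :: nat set)))
              \<and> (\<forall>x. g x \<ge> 0)
              \<and> (\<forall>t. AE \<omega> in M. lam t \<omega> = g (\<lambda>i. N (t - 1 - int i) \<omega>)))
       \<and> ergodic_process M N lam
       \<and> integrable M (\<lambda>\<omega>. (lam 1 \<omega>)\<^sup>2)"
proof -
  interpret contractive_poisson_process M N lam f \<kappa>\<^sub>1 \<kappa>\<^sub>2
    by (intro contractive_poisson_process.intro contractive_poisson_process_axioms.intro) fact+
  show ?thesis
  proof (intro conjI allI impI)
    show "beta_coeff M N n \<le> ennreal (2 * (\<integral>\<omega>. lam 1 \<omega> \<partial>M) * (\<kappa>\<^sub>1 + \<kappa>\<^sub>2) ^ (n - 1) / (1 - \<kappa>\<^sub>1))" if "n \<ge> 1" for n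
      using beta_coeff_le[OF that] by (simp add: rate_def)
    show "\<exists>g. g \<in> borel_measurable (PiM (UNIV :: nat set) (\<lambda>_. count_space (UNIV :: nat set)))
              \<and> (\<forall>x. g x \<ge> 0) \<and> (\<forall>t. AE \<omega> in M. lam t \<omega> = g (\<lambda>i. N (t - 1 - int i) \<omega>))"
      using borel_measurable_intensity intensity_nonneg lam_eq_intensity by blast
  qed (rule absolutely_regular_counts ergodic integrable_lam_square)+
qed

end
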